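(* Let $d=1$ and let $\mathbf X_n(\mathbf x)$ be the process $\mathbf X_{n+1}=\mathbf A_{n+1}\mathbf X_n+\mathbf B_{n+1}$ on $\mathbb R$ started at $\mathbf x$, driven by i.i.d. copies $(\mathbf A_n,\mathbf B_n)_{n\ge 1}$ of a pair $(\mathbf A,\mathbf B)$ of real random variables. Assume: (a) $\gamma_L<0$; (b) $\mathbb E|\mathbf A|^s<\infty$ for some $s>0$; (c) $\mathbb E\log^+|\mathbf B|<\infty$; (d) $\mathbb P(\mathbf A\mathbf x+\mathbf B=\mathbf x)<1$ for every $\mathbf x\in\mathbb R$; (e) there is $s_1>0$ with $h_{\mathbf A}(s_1)>1$, and there is $\alpha\in(0,\alpha_\infty)$ with $h_{\mathbf A}(\alpha)=1$; (f) the support of the stationary distribution $\nu_\infty$ is unbounded; (g) there are $R_0,z_0>1$, $C_0>0$ and $\alpha_+\in(\alpha,\alpha_\infty]$ such that $\mathbb P(|\mathbf A\mathbf x+\mathbf B|>zR)\le \frac{C_0}{z^{\alpha_+}}\,\mathbb P(|\mathbf A\mathbf x+\mathbf B|>R)$ for all $R\ge R_0$, $z\ge z_0$ and $\mathbf x$ with $|\mathbf x|\le R$; (h) there is $n_0\ge 1$ such that $\mathbb P(\mathbf x\Pi_{n_0}\mathbf y=0)<1$ for all nonzero $\mathbf x,\mathbf y\in\mathbb R$. Suppose moreover that $\alpha\ge2$. Then for all $\mathbf x_0\in\mathbb R$, $$0<\liminf_{R\to\infty}\frac{\mathbb E[\tau_R(\mathbf x_0)]}{R^\alpha}\le\limsup_{R\to\infty}\frac{\mathbb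 E[\tau_R(\mathbf x_0)]}{R^\alpha}<\infty .$$
   Context: $(\mathbf A_n,\mathbf B_n)_{n\ge1}$ are i.i.d. copies of the pair $(\mathbf A,\mathbf B)$ of real random variables (possibly dependent on each other); $\mathbf X_0(\mathbf x)=\mathbf x$, $\mathbf X_{n+1}(\mathbf x)=\mathbf A_{n+1}\mathbf X_n(\mathbf x)+\mathbf B_{n+1}$; $\log^+x=\log(x\vee1)$; $\Pi_n=\mathbf A_n\cdots\mathbf A_1$. In dimension one, the Lyapunov exponent is $\gamma_L=\lim_n\frac1n\mathbb E\log|\Pi_n|=\mathbb E\log|\mathbf A|$, and $h_{\mathbf A}(s)=\lim_n(\mathbb E|\Pi_n|^s)^{1/n}=\mathbb E|\mathbf A|^s$ for $s\ge0$. $\alpha_\infty=\sup\{s:\mathbb E|\mathbf A|^s<\infty\}$. Under (a)-(d) the process has a unique stationary distribution, denoted $\nu_\infty$. The exit time is $\tau_R(\mathbf x)=\inf\{n\ge0:|\mathbf X_n(\mathbf x)|>R\}$ with $\inf\emptyset=\infty$. *)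

theory Defs
  imports "HOL-Probability.Probability"
begin

text \<open>
  Sequences \<open>As\<close>, \<open>Bs\<close> are indexed by \<open>nat\<close>, but only the indices \<open>n \<ge> 1\<close> are used.
\<close>

definition iid_copies ::
  "'w measure \<Rightarrow> ('w \<Rightarrow> real) \<Rightarrow> ('w \<Rightarrow> real) \<Rightarrow> (nat \<Rightarrow> 'w \<Rightarrow> real) \<Rightarrow> (nat \<Rightarrow> 'w \<Rightarrow> real) \<Rightarrow> bool"
where
  "iid_copies M A B As Bs \<longleftrightarrow>
     prob_space.indep_vars M (\<lambda>_. borel \<Otimes>\<^sub>M borel) (\<lambda>n \<omega>. (As n \<omega>, Bs n \<omega>)) {1..} \<and>
     (\<forall>n\<ge>1. distr M (borel \<Otimes>\<^sub>M borel) (\<lambda>\<omega>. (As n \<omega>, Bs n \<omega>))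
          = distr M (borel \<Otimes>\<^sub>M borel) (\<lambda>\<omega>. (A \<omega>, B \<omega>)))"

primrec affine_rec ::
  "(nat \<Rightarrow> 'w \<Rightarrow> real) \<Rightarrow> (nat \<Rightarrow> 'w \<Rightarrow> real) \<Rightarrow> real \<Rightarrow> nat \<Rightarrow> 'w \<Rightarrow> real"
where
  "affine_rec As Bs x 0 \<omega> = x"
| "affine_rec As Bs x (Suc n) \<omega> = As (Suc n) \<omega> * affine_rec As Bs x n \<omega> + Bs (Suc n) \<omega>"

definition partial_prod :: "(nat \<Rightarrow> 'w \<Rightarrow> real) \<Rightarrow> nat \<Rightarrow> 'w \<Rightarrow> real" where
  "partial_prod As n \<omega> = (\<Prod>k\<in>{1..n}. As k \<omega>)"

text \<open>
  The variable \<open>A\<close> may vanish with positive probability, in which case \<open>log |A|\<close> takes the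
  value \<open>-\<infinity>\<close> (whereas \<open>ln 0 = 0\<close> in the library) and the Lyapunov exponent is \<open>-\<infinity>\<close>.
\<close>

definition log_abs :: "real \<Rightarrow> ereal" where
  "log_abs x = (if x = 0 then -\<infinity> else ereal (ln \<bar>x\<bar>))"

text \<open>
  Since \<open>e2ennreal\<close> maps negative values to \<open>0\<close>, this is the integral of the positive part minus
  the integral of the negative part. If both are infinite, the value is \<open>\<infinity>\<close>.
\<close>

definition ereal_expectation :: "'w measure \<Rightarrow> ('w \<Rightarrow> ereal) \<Rightarrow> ereal" where
  "ereal_expectation M f =
     enn2ereal (\<integral>\<^sup>+ \<omega>. e2ennreal (f \<omega>) \<partial>M) - enn2ereal (\<integral>\<^sup>+ \<omega>. e2ennreal (- f \<omega>) \<partial>M)"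

definition lyapunov_exponent :: "'w measure \<Rightarrow> (nat \<Rightarrow> 'w \<Rightarrow> real) \<Rightarrow> ereal" where
  "lyapunov_exponent M As =
     lim (\<lambda>n. ereal_expectation M (\<lambda>\<omega>. log_abs (partial_prod As n \<omega>)) / ereal (real n))"

definition ennreal_powr :: "ennreal \<Rightarrow> real \<Rightarrow> ennreal" where
  "ennreal_powr x p = (if x = \<infinity> then \<infinity> else ennreal (enn2real x powr p))"

text \<open>
  Used only for exponents \<open>s > 0\<close>; note that \<open>0 powr 0 = 0\<close> in the library.
\<close>

definition moment_growth :: "'w measure \<Rightarrow> (nat \<Rightarrow> 'w \<Rightarrow> real) \<Rightarrow> real \<Rightarrow> ennreal" where
  "moment_growth M As s =
     lim (\<lambda>n. ennreal_powr (\<integral>\<^sup>+ \<omega>. ennreal (\<bar>partial_prod As n \<omega>\<bar> powr s) \<partial>M) (1 / real n))"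

definition moment_abscissa :: "'w measure \<Rightarrow> ('w \<Rightarrow> real) \<Rightarrow> ereal" where
  "moment_abscissa M A =
     (SUP s \<in> {s::real. s \<ge> 0 \<and> (\<integral>\<^sup>+ \<omega>. ennreal (\<bar>A \<omega>\<bar> powr s) \<partial>M) < \<infinity>}. ereal s)"

text \<open>
  The law \<open>\<nu>\<close> is invariant under \<open>x \<mapsto> A x + B\<close>, with \<open>x\<close> distributed according to \<open>\<nu>\<close> and
  independent of the pair \<open>(A, B)\<close>.
\<close>

definition stationary_distribution ::
  "'w measure \<Rightarrow> ('w \<Rightarrow> real) \<Rightarrow> ('w \<Rightarrow> real) \<Rightarrow> real measure \<Rightarrow> bool"
where
  "stationary_distribution M A B \<nu> \<longleftrightarrow>
     prob_space \<nu> \<and> sets \<nu> = sets borel \<and>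
     distr (distr M (borel \<Otimes>\<^sub>M borel) (\<lambda>\<omega>. (A \<omega>, B \<omega>)) \<Otimes>\<^sub>M \<nu>) borel
       (\<lambda>((a, b), x). a * x + b) = \<nu>"

definition measure_support :: "'b::topological_space measure \<Rightarrow> 'b set" where
  "measure_support \<nu> = {x. \<forall>U. open U \<longrightarrow> x \<in> U \<longrightarrow> emeasure \<nu> U > 0}"

definition exit_time ::
  "(nat \<Rightarrow> 'w \<Rightarrow> real) \<Rightarrow> (nat \<Rightarrow> 'w \<Rightarrow> real) \<Rightarrow> real \<Rightarrow> real \<Rightarrow> 'w \<Rightarrow> enat"
where
  "exit_time As Bs R x \<omega> = (INF n \<in> {n. \<bar>affine_rec As Bs x n \<omega>\<bar> > R}. enat n)"

definition expected_exit_time ::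
  "'w measure \<Rightarrow> (nat \<Rightarrow> 'w \<Rightarrow> real) \<Rightarrow> (nat \<Rightarrow> 'w \<Rightarrow> real) \<Rightarrow> real \<Rightarrow> real \<Rightarrow> ennreal"
where
  "expected_exit_time M As Bs R x = (\<integral>\<^sup>+ \<omega>. ennreal_of_enat (exit_time As Bs R x \<omega>) \<partial>M)"

end

theory Submission
  imports Defs
begin

text \<open>
  Since \<open>E|A|^\<alpha> = 1\<close> and \<open>|A|\<close> is not a.s. \<open>1\<close>, \<open>E|A|^s < 1\<close> for \<open>0 < s < \<alpha>\<close>. Hence
  under one step \<open>|x|^\<alpha>\<close> changes in mean by at most \<open>O(1 + |x|^(\<alpha>-1))\<close>, while
  \<open>|x|^(\<alpha>-1)\<close> is contracted up to a constant. So \<open>|x|^\<alpha> + K |x|^(\<alpha>-1)\<close> has drift bounded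
  above, and \<open>|x|^\<alpha> - K |x|^(\<alpha>-1)\<close> can be modified to a function of the same order whose drift
  is bounded below by a positive constant. Optional stopping at the exit time, where the
  tail hypothesis keeps the mean of the overshoot \<open>|X_\<tau>|^\<alpha>\<close> of order \<open>R^\<alpha>\<close>, bounds the
  expected exit time from both sides by multiples of \<open>R^\<alpha>\<close>.
\<close>

section \<open>Inequalities for powers\<close>

text \<open>Since E|Ax|^\<alpha> = |x|^\<alpha> holds exactly, only the translation by B changes the
  mean of |x|^\<alpha>, and a mean value bound makes that change O(1 + |x|^(\<alpha>-1)). K is tuned
  so that the contraction of |x|^(\<alpha>-1) outweighs this error. The lower drift bound is the
  delicate one: near the origin the function with the minus sign may be negative and its drift need
  not be positive. What keeps the recursion from staying in a bounded region is the unbounded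
  support of the stationary law, together with E|A| < 1, which makes the iterates of the transition
  operator on bounded Lipschitz functions nearly constant on bounded sets. The tail hypothesis does
  double work: at x = 0 it yields E|B|^\<alpha> < \<infinity>, and for |x| \<le> R it compares the
  overshoot with the probability of leaving in that very step, so that the overshoot costs add up to
  a single multiple of R^\<alpha>. Finiteness of E \<tau> is not presupposed: the upper bound comes
  from bounded horizons and then feeds the lower bound.\<close>

lemma powr_weighted_strict:
  fixes u s p :: real
  assumes "0 < s" "s < p" "0 \<le> u" "u \<noteq> 1"
  shows "u powr s < s / p * u powr p + (1 - s / p)"
proof (cases "u = 0")
  case True
  then show ?thesis using assms by simp
next
  case False
  then have u: "u > 0" using assms by simp
  define \<theta> v where "\<theta> = s / p" and "v = p * ln u"
  have th: "0 < \<theta>" "\<theta> < 1" using assms by (auto simp: \<theta>_def)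
  have v: "v \<noteq> 0" using assms u by (auto simp: v_def)
  have es: "u powr s = exp (\<theta> * v)" and ep: "u powr p = exp v"
    using u assms by (auto simp: powr_def \<theta>_def v_def)
  \<comment> \<open>Facts \<open>1\<close> and \<open>2\<close> say that the tangent of exp at
    \<theta> v lies strictly below exp at the points v and 0. Averaging with weights \<theta> and 1
    - \<theta> cancels the slopes.\<close>
  have 1: "exp (\<theta> * v) * (1 + (1 - \<theta>) * v) < exp v"
  proof -
    have "exp v = exp (\<theta> * v) * exp ((1 - \<theta>) * v)"
      by (simp add: exp_add[symmetric] algebra_simps)
    moreover have "1 + (1 - \<theta>) * v < exp ((1 - \<theta>) * v)"
      using exp_minus_greater[of "- ((1 - \<theta>) * v)"] th v by simp
    ultimately show ?thesis by simp
  qed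
  have 2: "exp (\<theta> * v) * (1 - \<theta> * v) < 1"
  proof -
    have "1 - \<theta> * v < exp (- (\<theta> * v))"
      using exp_minus_greater[of "\<theta> * v"] th v by simp
    then have "exp (\<theta> * v) * (1 - \<theta> * v) < exp (\<theta> * v) * exp (- (\<theta> * v))" by simp
    then show ?thesis by (simp add: exp_minus)
  qed
  have "\<theta> * (exp (\<theta> * v) * (1 + (1 - \<theta>) * v)) + (1 - \<theta>) * (exp (\<theta> * v) * (1 - \<theta> * v))
      < \<theta> * exp v + (1 - \<theta>) * 1"
    using 1 2 th by (intro add_strict_mono mult_strict_left_mono) auto
  then show ?thesis
    unfolding es ep \<theta>_def[symmetric] by (simp add: algebra_simps)
qed

text \<open>Bernoulli's inequality 1 - w^p \<le> p (1 - w) at w = u/v, read off from the weighted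
  inequality with s = 1 and rescaled by v^p; this gives the mean value bound without
  derivatives.\<close>

lemma powr_diff_le:
  fixes u v p :: real
  assumes "1 < p" "0 \<le> u" "u \<le> v"
  shows "v powr p - u powr p \<le> p * (v - u) * v powr (p - 1)"
proof (cases "v = 0")
  case True
  then show ?thesis using assms by simp
next
  case False
  then have v: "v > 0" using assms by simp
  have "u / v \<le> 1 / p * (u / v) powr p + (1 - 1 / p)"
  proof (cases "u / v = 1")
    case True
    then show ?thesis by simp
  next
    case False
    with powr_weighted_strict[of 1 p "u / v"] assms v show ?thesis by simp
  qed
  then have "p * (u / v) \<le> p * (1 / p * (u / v) powr p + (1 - 1 / p))"
    using assms by (intro mult_left_mono) auto
  also have "\<dots> = (u / v) powr p + (p - 1)"
    using assms by (simp add: distrib_left right_diff_distrib)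
  finally have "p * (u / v) \<le> (u / v) powr p + (p - 1)" .
  then have "v powr p * (1 - (u / v) powr p) \<le> v powr p * (p * (1 - u / v))"
    by (intro mult_left_mono) (auto simp: algebra_simps)
  moreover have "v powr p * (1 - (u / v) powr p) = v powr p - u powr p"
    using assms v by (simp add: powr_divide algebra_simps)
  moreover have "v powr p * (p * (1 - u / v)) = p * (v - u) * v powr (p - 1)"
    using v by (simp add: powr_diff field_simps)
  ultimately show ?thesis by simp
qed

lemma abs_powr_diff_le:
  fixes a b p :: real
  assumes "1 < p"
  shows "\<bar>\<bar>a + b\<bar> powr p - \<bar>a\<bar> powr p\<bar> \<le> p * \<bar>b\<bar> * (\<bar>a\<bar> + \<bar>b\<bar>) powr (p - 1)"
proof -
  have *: "v powr p - u powr p \<le> p * \<bar>b\<bar> * (\<bar>a\<bar> + \<bar>b\<bar>) powr (p - 1)"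
    if "0 \<le> u" "u \<le> v" "v - u \<le> \<bar>b\<bar>" "v \<le> \<bar>a\<bar> + \<bar>b\<bar>" for u v
  proof -
    have "p * (v - u) * v powr (p - 1) \<le> p * \<bar>b\<bar> * (\<bar>a\<bar> + \<bar>b\<bar>) powr (p - 1)"
      using that assms by (intro mult_mono powr_mono2) auto
    with powr_diff_le[of p u v] that assms show ?thesis by linarith
  qed
  show ?thesis
  proof (cases "\<bar>a\<bar> \<le> \<bar>a + b\<bar>")
    case True
    then have "\<bar>a\<bar> powr p \<le> \<bar>a + b\<bar> powr p" using assms by (intro powr_mono2) auto
    with *[of "\<bar>a\<bar>" "\<bar>a + b\<bar>"] True show ?thesis by auto
  next
    case False
    then have "\<bar>a + b\<bar> powr p \<le> \<bar>a\<bar> powr p" using assms by (intro powr_mono2) auto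
    with *[of "\<bar>a + b\<bar>" "\<bar>a\<bar>"] False show ?thesis by auto
  qed
qed

text \<open>Either b \<le> \<eta> a, and b is absorbed into the factor (1 + \<eta>)^q = 1 + e, or a
  is at most b/\<eta>, and both terms are comparable with b. A factor on a^q arbitrarily close to 1
  lets a strict contraction survive the addition of B.\<close>

lemma powr_add_le:
  fixes q e :: real
  assumes "0 < q" "0 < e"
  obtains C where "0 \<le> C"
    "\<And>a b :: real. 0 \<le> a \<Longrightarrow> 0 \<le> b \<Longrightarrow> (a + b) powr q \<le> (1 + e) * a powr q + C * b powr q"
proof
  define \<eta> where "\<eta> = (1 + e) powr (1 / q) - 1"
  have \<eta>: "\<eta> > 0" using assms by (simp add: \<eta>_def)
  have \<eta>q: "(1 + \<eta>) powr q = 1 + e" using assms by (simp add: \<eta>_def powr_powr)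
  let ?C = "(1 / \<eta> + 1) powr q"
  show "0 \<le> ?C" by simp
  fix a b :: real assume ab: "0 \<le> a" "0 \<le> b"
  show "(a + b) powr q \<le> (1 + e) * a powr q + ?C * b powr q"
  proof (cases "b \<le> \<eta> * a")
    case True
    have "(a + b) powr q \<le> ((1 + \<eta>) * a) powr q"
      using True ab assms by (intro powr_mono2) (auto simp: algebra_simps)
    also have "\<dots> = (1 + e) * a powr q" using ab \<eta> by (simp add: powr_mult \<eta>q)
    finally show ?thesis by (smt (verit) ab powr_ge_zero mult_nonneg_nonneg)
  next
    case False
    have "a \<le> b / \<eta>" using False \<eta> by (simp add: field_simps)
    then have "(a + b) powr q \<le> ((1 / \<eta> + 1) * b) powr q"
      using ab assms by (intro powr_mono2) (auto simp: algebra_simps)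
    also have "\<dots> = ?C * b powr q" using ab \<eta> by (simp add: powr_mult)
    also have "\<dots> \<le> (1 + e) * a powr q + ?C * b powr q" using assms by simp
    finally show ?thesis .
  qed
qed

lemma powr_add_le_two:
  fixes a b q :: real
  assumes "0 \<le> q" "0 \<le> a" "0 \<le> b"
  shows "(a + b) powr q \<le> 2 powr q * (a powr q + b powr q)"
proof -
  have "(a + b) powr q \<le> (2 * max a b) powr q" using assms by (intro powr_mono2) auto
  also have "\<dots> = 2 powr q * max a b powr q" using assms by (simp add: powr_mult)
  also have "\<dots> \<le> 2 powr q * (a powr q + b powr q)"
    by (intro mult_left_mono) (auto simp: max_def)
  finally show ?thesis .
qed

text \<open>Layer-cake formula behind E \<tau> = sum of P(\<tau> > n); the value t = \<infinity> is
  included.\<close>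

lemma ennreal_of_enat_eq_suminf:
  "ennreal_of_enat t = (\<Sum>n. if enat n < t then 1 else 0)"
proof (cases t)
  case (enat m)
  have "(\<Sum>n. if enat n < t then 1 else 0 :: ennreal) = (\<Sum>n<m. if enat n < t then 1 else 0)"
    by (rule suminf_finite) (auto simp: enat)
  also have "\<dots> = of_nat m" by (simp add: enat)
  finally show ?thesis by (simp add: enat)
next
  case infinity
  have "(\<Sum>n. 1 :: ennreal) = \<infinity>"
  proof -
    have "of_nat m \<le> (\<Sum>n. 1 :: ennreal)" for m :: nat
      using sum_le_suminf[of "\<lambda>_. 1 :: ennreal" "{..<m}"] by simp
    then show ?thesis
      by (metis ennreal_Ex_less_of_nat infinity_ennreal_def leD top.not_eq_extremum)
  qed
  then show ?thesis by (simp add: infinity)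
qed

section \<open>The transition operator of a random affine map\<close>

locale random_affine_map = prob_space M for M :: "'w measure" +
  fixes A B :: "'w \<Rightarrow> real"
  assumes A_measurable [measurable]: "A \<in> borel_measurable M"
    and B_measurable [measurable]: "B \<in> borel_measurable M"
begin

text \<open>The transition operator of the Markov chain on nonnegative functions. Values in
  \<open>ennreal\<close> remove integrability conditions, so that it can be iterated freely.\<close>

definition step :: "(real \<Rightarrow> ennreal) \<Rightarrow> real \<Rightarrow> ennreal" where
  "step f x = (\<integral>\<^sup>+ \<omega>. f (A \<omega> * x + B \<omega>) \<partial>M)"

lemma step_measurable [measurable]:
  assumes [measurable]: "f \<in> borel_measurable borel"
  shows "step f \<in> borel_measurable borel"
  unfolding step_def by measurable

lemma step_iterate_measurable [measurable]:
  "f \<in> borel_measurable borel \<Longrightarrow> (step ^^ n) f \<in> borel_measurable borel"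
  by (induction n) auto

lemma step_mono: "(\<And>x. f x \<le> g x) \<Longrightarrow> step f x \<le> step g x"
  unfolding step_def by (intro nn_integral_mono) auto

lemma step_iterate_mono: "(\<And>x. f x \<le> g x) \<Longrightarrow> (step ^^ n) f x \<le> (step ^^ n) g x"
  by (induction n arbitrary: x) (auto intro: step_mono)

lemma step_cmult:
  assumes [measurable]: "f \<in> borel_measurable borel"
  shows "step (\<lambda>x. c * f x) x = c * step f x"
  unfolding step_def by (intro nn_integral_cmult) measurable

lemma step_sum:
  assumes "\<And>k. k \<in> I \<Longrightarrow> f k \<in> borel_measurable borel"
  shows "step (\<lambda>x. \<Sum>k\<in>I. f k x) x = (\<Sum>k\<in>I. step (f k) x)"
  unfolding step_def using assms by (intro nn_integral_sum) auto

text \<open>Tonelli turns invariance of the law into invariance of the integral, so all iterates of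
  a function share one mean under \<nu>.\<close>

lemma stationary_step:
  assumes st: "stationary_distribution M A B \<nu>" and f [measurable]: "f \<in> borel_measurable borel"
  shows "(\<integral>\<^sup>+ x. step f x \<partial>\<nu>) = (\<integral>\<^sup>+ x. f x \<partial>\<nu>)"
proof -
  let ?D = "distr M (borel \<Otimes>\<^sub>M borel) (\<lambda>\<omega>. (A \<omega>, B \<omega>))"
  from st have \<nu>: "prob_space \<nu>" and sets [measurable_cong]: "sets \<nu> = sets borel"
    and inv: "distr (?D \<Otimes>\<^sub>M \<nu>) borel (\<lambda>((a, b), x). a * x + b) = \<nu>"
    by (auto simp: stationary_distribution_def)
  interpret \<nu>: prob_space \<nu> by fact
  interpret D: prob_space ?D by (rule prob_space_distr) measurable
  interpret pair_sigma_finite ?D \<nu> ..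
  have "(\<integral>\<^sup>+ x. f x \<partial>\<nu>) = (\<integral>\<^sup>+ z. f (fst (fst z) * snd z + snd (fst z)) \<partial>(?D \<Otimes>\<^sub>M \<nu>))"
    by (subst inv[symmetric], subst nn_integral_distr) (auto simp: split_beta')
  also have "\<dots> = (\<integral>\<^sup>+ x. (\<integral>\<^sup>+ p. f (fst p * x + snd p) \<partial>?D) \<partial>\<nu>)"
    by (subst nn_integral_snd[symmetric]) auto
  also have "\<dots> = (\<integral>\<^sup>+ x. step f x \<partial>\<nu>)"
    unfolding step_def by (intro nn_integral_cong, subst nn_integral_distr) (auto simp: split_beta)
  finally show ?thesis by simp
qed

lemma stationary_step_iterate:
  assumes "stationary_distribution M A B \<nu>" "f \<in> borel_measurable borel"
  shows "(\<integral>\<^sup>+ x. (step ^^ n) f x \<partial>\<nu>) = (\<integral>\<^sup>+ x. f x \<partial>\<nu>)"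
  by (induction n) (use assms in \<open>auto simp: stationary_step\<close>)

end

section \<open>The recursion and its exit time\<close>

lemma (in prob_space) nn_integral_indep_var:
  assumes ind: "indep_var S X T Y" and f [measurable]: "f \<in> borel_measurable (S \<Otimes>\<^sub>M T)"
  shows "(\<integral>\<^sup>+ \<omega>. f (X \<omega>, Y \<omega>) \<partial>M) = (\<integral>\<^sup>+ \<omega>. (\<integral>\<^sup>+ y. f (X \<omega>, y) \<partial>distr M T Y) \<partial>M)"
proof -
  from ind have X [measurable]: "X \<in> M \<rightarrow>\<^sub>M S" and Y [measurable]: "Y \<in> M \<rightarrow>\<^sub>M T"
    and eq: "distr M S X \<Otimes>\<^sub>M distr M T Y = distr M (S \<Otimes>\<^sub>M T) (\<lambda>\<omega>. (X \<omega>, Y \<omega>))"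
    by (auto simp: indep_var_distribution_eq)
  interpret T: prob_space "distr M T Y" by (rule prob_space_distr) measurable
  have "(\<integral>\<^sup>+ \<omega>. f (X \<omega>, Y \<omega>) \<partial>M) = (\<integral>\<^sup>+ z. f z \<partial>(distr M S X \<Otimes>\<^sub>M distr M T Y))"
    unfolding eq by (subst nn_integral_distr) measurable
  also have "\<dots> = (\<integral>\<^sup>+ x. (\<integral>\<^sup>+ y. f (x, y) \<partial>distr M T Y) \<partial>distr M S X)"
    by (intro T.nn_integral_fst[symmetric]) measurable
  also have "\<dots> = (\<integral>\<^sup>+ \<omega>. (\<integral>\<^sup>+ y. f (X \<omega>, y) \<partial>distr M T Y) \<partial>M)"
    by (subst nn_integral_distr) (auto intro!: T.borel_measurable_nn_integral_fst)
  finally show ?thesis .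
qed

locale affine_recursion = random_affine_map +
  fixes As Bs :: "nat \<Rightarrow> 'a \<Rightarrow> real"
  assumes iid: "iid_copies M A B As Bs"
begin

lemma pair_measurable: "n \<ge> 1 \<Longrightarrow> (\<lambda>\<omega>. (As n \<omega>, Bs n \<omega>)) \<in> M \<rightarrow>\<^sub>M borel \<Otimes>\<^sub>M borel"
  using iid unfolding iid_copies_def by (auto simp: indep_vars_def)

lemma As_measurable: "n \<ge> 1 \<Longrightarrow> As n \<in> borel_measurable M"
  using measurable_compose[OF pair_measurable measurable_fst] by simp

lemma Bs_measurable: "n \<ge> 1 \<Longrightarrow> Bs n \<in> borel_measurable M"
  using measurable_compose[OF pair_measurable measurable_snd] by simp

lemma affine_rec_measurable [measurable]: "affine_rec As Bs x n \<in> borel_measurable M"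
  by (induction n) (auto intro!: borel_measurable_add borel_measurable_times As_measurable Bs_measurable)

text \<open>The first n pairs are independent of the next one, which may therefore be replaced by a
  fresh copy of (A, B). Every use of independence passes through this identity.\<close>

lemma nn_integral_history:
  fixes F :: "(nat \<Rightarrow> real \<times> real) \<Rightarrow> real \<times> real \<Rightarrow> ennreal"
  assumes [measurable]: "case_prod F \<in> borel_measurable (Pi\<^sub>M {1..n} (\<lambda>_. borel \<Otimes>\<^sub>M borel) \<Otimes>\<^sub>M (borel \<Otimes>\<^sub>M borel))"
  shows "(\<integral>\<^sup>+ \<omega>. F (\<lambda>i\<in>{1..n}. (As i \<omega>, Bs i \<omega>)) (As (Suc n) \<omega>, Bs (Suc n) \<omega>) \<partial>M)
    = (\<integral>\<^sup>+ \<omega>. (\<integral>\<^sup>+ \<omega>'. F (\<lambda>i\<in>{1..n}. (As i \<omega>, Bs i \<omega>)) (A \<omega>', B \<omega>') \<partial>M) \<partial>M)"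
proof -
  let ?P = "borel \<Otimes>\<^sub>M borel :: (real \<times> real) measure"
  let ?X = "\<lambda>i \<omega>. (As i \<omega>, Bs i \<omega>)"
  have vars: "indep_vars (\<lambda>_. ?P) ?X {1..}"
    and dist: "distr M ?P (?X (Suc n)) = distr M ?P (\<lambda>\<omega>. (A \<omega>, B \<omega>))"
    using iid by (auto simp: iid_copies_def)
  let ?S = "Pi\<^sub>M {1..n} (\<lambda>_. ?P)" and ?T = "Pi\<^sub>M {Suc n} (\<lambda>_. ?P)"
  \<comment> \<open>The single pair with index n + 1 is treated as a one-element family, because
    independence of blocks is stated for product spaces over index sets.\<close>
  let ?H = "\<lambda>\<omega>. \<lambda>i\<in>{1..n}. ?X i \<omega>" and ?K = "\<lambda>\<omega>. \<lambda>i\<in>{Suc n}. ?X i \<omega>"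
  have ind: "indep_var ?S ?H ?T ?K"
    by (rule indep_var_restrict[OF vars]) auto
  have H: "?H \<in> M \<rightarrow>\<^sub>M ?S" and K [measurable]: "?K \<in> M \<rightarrow>\<^sub>M ?T"
    by (intro measurable_restrict pair_measurable; auto)+
  have comp [measurable]: "(\<lambda>y. y (Suc n)) \<in> ?T \<rightarrow>\<^sub>M ?P"
    by (intro measurable_component_singleton) auto
  have X [measurable]: "?X (Suc n) \<in> M \<rightarrow>\<^sub>M ?P"
    by (rule pair_measurable) simp
  have "(\<integral>\<^sup>+ \<omega>. F (?H \<omega>) (?X (Suc n) \<omega>) \<partial>M) = (\<integral>\<^sup>+ \<omega>. (\<lambda>(h, y). F h (y (Suc n))) (?H \<omega>, ?K \<omega>) \<partial>M)"
    by simp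
  also have "\<dots> = (\<integral>\<^sup>+ \<omega>. (\<integral>\<^sup>+ y. (\<lambda>(h, y). F h (y (Suc n))) (?H \<omega>, y) \<partial>distr M ?T ?K) \<partial>M)"
    by (rule nn_integral_indep_var[OF ind]) measurable
  also have "\<dots> = (\<integral>\<^sup>+ \<omega>. (\<integral>\<^sup>+ \<omega>'. F (?H \<omega>) (A \<omega>', B \<omega>') \<partial>M) \<partial>M)"
  proof (rule nn_integral_cong)
    fix \<omega> assume "\<omega> \<in> space M"
    then have "?H \<omega> \<in> space ?S" using H by (rule measurable_space[rotated])
    then have FH [measurable]: "F (?H \<omega>) \<in> borel_measurable ?P" by measurable
    have [measurable]: "(\<lambda>y. F (?H \<omega>) (y (Suc n))) \<in> borel_measurable ?T"
      by (rule measurable_compose[OF comp FH])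
    have "(\<integral>\<^sup>+ y. F (?H \<omega>) (y (Suc n)) \<partial>distr M ?T ?K) = (\<integral>\<^sup>+ \<omega>'. F (?H \<omega>) (?X (Suc n) \<omega>') \<partial>M)"
      by (subst nn_integral_distr) (auto simp del: One_nat_def)
    also have "\<dots> = (\<integral>\<^sup>+ p. F (?H \<omega>) p \<partial>distr M ?P (?X (Suc n)))"
      by (subst nn_integral_distr) (auto simp del: One_nat_def)
    also have "\<dots> = (\<integral>\<^sup>+ \<omega>'. F (?H \<omega>) (A \<omega>', B \<omega>') \<partial>M)"
      unfolding dist by (subst nn_integral_distr) (auto simp del: One_nat_def)
    finally show "(\<integral>\<^sup>+ y. (\<lambda>(h, y). F h (y (Suc n))) (?H \<omega>, y) \<partial>distr M ?T ?K)
      = (\<integral>\<^sup>+ \<omega>'. F (?H \<omega>) (A \<omega>', B \<omega>') \<partial>M)" by simp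
  qed
  finally show ?thesis .
qed

text \<open>Running the recursion on the coordinate space, where a sample point is itself the
  sequence of pairs, exhibits X_k as a function of the history; only the pairs 1 to k enter.\<close>

lemma affine_rec_history:
  assumes "k \<le> n"
  shows "affine_rec (\<lambda>i h. fst (h i)) (\<lambda>i h. snd (h i)) x k (\<lambda>i\<in>{1..n}. (As i \<omega>, Bs i \<omega>))
    = affine_rec As Bs x k \<omega>"
  using assms by (induction k) auto

lemma affine_rec_coordinate_measurable:
  assumes "k \<le> n"
  shows "affine_rec (\<lambda>i h. fst (h i)) (\<lambda>i h. snd (h i)) x k
    \<in> borel_measurable (Pi\<^sub>M {1..n} (\<lambda>_. borel \<Otimes>\<^sub>M borel))"
  using assms
proof (induction k)
  case 0
  then show ?case by simp
next
  case (Suc k)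
  then have [measurable]: "affine_rec (\<lambda>i h. fst (h i)) (\<lambda>i h. snd (h i)) x k
      \<in> borel_measurable (Pi\<^sub>M {1..n} (\<lambda>_. borel \<Otimes>\<^sub>M borel))" by simp
  have [measurable]: "(\<lambda>h. h (Suc k)) \<in> Pi\<^sub>M {1..n} (\<lambda>_. borel \<Otimes>\<^sub>M borel) \<rightarrow>\<^sub>M (borel \<Otimes>\<^sub>M borel :: (real \<times> real) measure)"
    using Suc by (intro measurable_component_singleton) auto
  show ?case unfolding affine_rec.simps by measurable
qed

text \<open>Indicator of \<tau> > n, with values in \<open>ennreal\<close> so that it can serve as a
  weight.\<close>

definition alive :: "real \<Rightarrow> real \<Rightarrow> nat \<Rightarrow> 'a \<Rightarrow> ennreal" where
  "alive R x n \<omega> = (if \<forall>k\<le>n. \<bar>affine_rec As Bs x k \<omega>\<bar> \<le> R then 1 else 0)"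

lemma alive_measurable [measurable]: "alive R x n \<in> borel_measurable M"
  unfolding alive_def[abs_def] by measurable

text \<open>Markov property at time n: both the event \<tau> > n and X_n are functions of the first
  n pairs.\<close>

lemma nn_integral_alive_step:
  assumes f [measurable]: "f \<in> borel_measurable borel"
  shows "(\<integral>\<^sup>+ \<omega>. alive R x n \<omega> * f (affine_rec As Bs x (Suc n) \<omega>) \<partial>M)
    = (\<integral>\<^sup>+ \<omega>. alive R x n \<omega> * step f (affine_rec As Bs x n \<omega>) \<partial>M)"
proof -
  let ?X = "affine_rec (\<lambda>i h. fst (h i)) (\<lambda>i h. snd (h i)) x :: nat \<Rightarrow> (nat \<Rightarrow> real \<times> real) \<Rightarrow> real"
  let ?al = "\<lambda>h. if \<forall>k\<le>n. \<bar>?X k h\<bar> \<le> R then 1 else 0 :: ennreal"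
  let ?F = "\<lambda>h p. ?al h * f (fst p * ?X n h + snd p)"
  let ?H = "\<lambda>\<omega>. \<lambda>i\<in>{1..n}. (As i \<omega>, Bs i \<omega>)"
  have [measurable]: "?X k \<in> borel_measurable (Pi\<^sub>M {1..n} (\<lambda>_. borel \<Otimes>\<^sub>M borel))" if "k \<le> n" for k
    using that by (rule affine_rec_coordinate_measurable)
  have al: "?al (?H \<omega>) = alive R x n \<omega>" for \<omega>
    by (simp add: alive_def affine_rec_history del: One_nat_def cong: if_cong)
  have [measurable]: "?al \<in> borel_measurable (Pi\<^sub>M {1..n} (\<lambda>_. borel \<Otimes>\<^sub>M borel))"
  proof -
    have "?al = (\<lambda>h. \<Prod>k\<le>n. if \<bar>?X k h\<bar> \<le> R then 1 else 0)"
    proof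
      fix h
      show "?al h = (\<Prod>k\<le>n. if \<bar>?X k h\<bar> \<le> R then 1 else 0)"
        by (cases "\<forall>k\<le>n. \<bar>?X k h\<bar> \<le> R") (auto simp: prod_zero_iff)
    qed
    moreover have "\<dots> \<in> borel_measurable (Pi\<^sub>M {1..n} (\<lambda>_. borel \<Otimes>\<^sub>M borel))"
      by (rule borel_measurable_prod_ennreal) measurable
    ultimately show ?thesis by simp
  qed
  have Xn: "?X n \<in> borel_measurable (Pi\<^sub>M {1..n} (\<lambda>_. borel \<Otimes>\<^sub>M borel))"
    by (rule affine_rec_coordinate_measurable) simp
  note [measurable] = Xn
  have "(\<integral>\<^sup>+ \<omega>. ?F (?H \<omega>) (As (Suc n) \<omega>, Bs (Suc n) \<omega>) \<partial>M)
      = (\<integral>\<^sup>+ \<omega>. (\<integral>\<^sup>+ \<omega>'. ?F (?H \<omega>) (A \<omega>', B \<omega>') \<partial>M) \<partial>M)"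
    by (rule nn_integral_history) measurable
  then have "(\<integral>\<^sup>+ \<omega>. alive R x n \<omega> * f (affine_rec As Bs x (Suc n) \<omega>) \<partial>M)
      = (\<integral>\<^sup>+ \<omega>. (\<integral>\<^sup>+ \<omega>'. alive R x n \<omega> * f (A \<omega>' * affine_rec As Bs x n \<omega> + B \<omega>') \<partial>M) \<partial>M)"
    by (simp only: al fst_conv snd_conv affine_rec_history[OF order_refl] affine_rec.simps)
  also have "\<dots> = (\<integral>\<^sup>+ \<omega>. alive R x n \<omega> * step f (affine_rec As Bs x n \<omega>) \<partial>M)"
    unfolding step_def by (intro nn_integral_cong nn_integral_cmult) measurable
  finally show ?thesis .
qed

lemma exit_time_gt_iff:
  "enat n < exit_time As Bs R x \<omega> \<longleftrightarrow> (\<forall>k\<le>n. \<bar>affine_rec As Bs x k \<omega>\<bar> \<le> R)"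
proof
  assume less: "enat n < exit_time As Bs R x \<omega>"
  show "\<forall>k\<le>n. \<bar>affine_rec As Bs x k \<omega>\<bar> \<le> R"
  proof (intro allI impI, rule ccontr)
    fix k assume k: "k \<le> n" "\<not> \<bar>affine_rec As Bs x k \<omega>\<bar> \<le> R"
    then have "exit_time As Bs R x \<omega> \<le> enat k"
      unfolding exit_time_def by (intro INF_lower) auto
    also have "\<dots> \<le> enat n" using k by simp
    finally show False using less by simp
  qed
next
  assume al: "\<forall>k\<le>n. \<bar>affine_rec As Bs x k \<omega>\<bar> \<le> R"
  have "enat (Suc n) \<le> exit_time As Bs R x \<omega>"
    unfolding exit_time_def
  proof (rule INF_greatest)
    fix k assume "k \<in> {n. R < \<bar>affine_rec As Bs x n \<omega>\<bar>}"
    with al have "\<not> k \<le> n" by (auto simp: not_less[symmetric])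
    then show "enat (Suc n) \<le> enat k" by simp
  qed
  then show "enat n < exit_time As Bs R x \<omega>"
    by (rule less_le_trans[rotated]) simp
qed

lemma expected_exit_time_eq:
  "expected_exit_time M As Bs R x = (\<Sum>n. \<integral>\<^sup>+ \<omega>. alive R x n \<omega> \<partial>M)"
proof -
  have "expected_exit_time M As Bs R x = (\<integral>\<^sup>+ \<omega>. (\<Sum>n. alive R x n \<omega>) \<partial>M)"
    unfolding expected_exit_time_def ennreal_of_enat_eq_suminf exit_time_gt_iff alive_def ..
  also have "\<dots> = (\<Sum>n. \<integral>\<^sup>+ \<omega>. alive R x n \<omega> \<partial>M)"
    by (rule nn_integral_suminf) measurable
  finally show ?thesis .
qed

lemma nn_integral_partial_prod:
  "(\<integral>\<^sup>+ \<omega>. ennreal (\<bar>partial_prod As n \<omega>\<bar> powr s) \<partial>M) = (\<integral>\<^sup>+ \<omega>. ennreal (\<bar>A \<omega>\<bar> powr s) \<partial>M) ^ n"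
proof (induction n)
  case 0
  then show ?case by (simp add: partial_prod_def emeasure_space_1)
next
  case (Suc n)
  let ?P = "\<lambda>h :: nat \<Rightarrow> real \<times> real. \<Prod>k\<in>{1..n}. fst (h k)"
  let ?F = "\<lambda>h p. ennreal (\<bar>?P h\<bar> powr s) * ennreal (\<bar>fst p\<bar> powr s)"
  let ?H = "\<lambda>\<omega>. \<lambda>i\<in>{1..n}. (As i \<omega>, Bs i \<omega>)"
  have [measurable]: "partial_prod As n \<in> borel_measurable M"
    unfolding partial_prod_def by (intro borel_measurable_prod As_measurable) auto
  have [measurable]: "?P \<in> borel_measurable (Pi\<^sub>M {1..n} (\<lambda>_. borel \<Otimes>\<^sub>M borel))"
  proof (intro borel_measurable_prod)
    fix k assume "k \<in> {1..n}"
    then have [measurable]: "(\<lambda>h. h k) \<in> Pi\<^sub>M {1..n} (\<lambda>_. borel \<Otimes>\<^sub>M borel) \<rightarrow>\<^sub>M (borel \<Otimes>\<^sub>M borel :: (real \<times> real) measure)"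
      by (rule measurable_component_singleton)
    show "(\<lambda>h. fst (h k)) \<in> borel_measurable (Pi\<^sub>M {1..n} (\<lambda>_. borel \<Otimes>\<^sub>M borel :: (real \<times> real) measure))"
      by measurable
  qed
  have P: "?P (?H \<omega>) = partial_prod As n \<omega>" for \<omega>
    by (simp add: partial_prod_def)
  have "(\<integral>\<^sup>+ \<omega>. ?F (?H \<omega>) (As (Suc n) \<omega>, Bs (Suc n) \<omega>) \<partial>M)
      = (\<integral>\<^sup>+ \<omega>. (\<integral>\<^sup>+ \<omega>'. ?F (?H \<omega>) (A \<omega>', B \<omega>') \<partial>M) \<partial>M)"
    by (rule nn_integral_history) measurable
  then have "(\<integral>\<^sup>+ \<omega>. ennreal (\<bar>partial_prod As n \<omega>\<bar> powr s) * ennreal (\<bar>As (Suc n) \<omega>\<bar> powr s) \<partial>M)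
      = (\<integral>\<^sup>+ \<omega>. (\<integral>\<^sup>+ \<omega>'. ennreal (\<bar>partial_prod As n \<omega>\<bar> powr s) * ennreal (\<bar>A \<omega>'\<bar> powr s) \<partial>M) \<partial>M)"
    by (simp only: P fst_conv)
  also have "\<dots> = (\<integral>\<^sup>+ \<omega>. ennreal (\<bar>partial_prod As n \<omega>\<bar> powr s) * (\<integral>\<^sup>+ \<omega>. ennreal (\<bar>A \<omega>\<bar> powr s) \<partial>M) \<partial>M)"
    by (intro nn_integral_cong nn_integral_cmult) measurable
  also have "\<dots> = (\<integral>\<^sup>+ \<omega>. ennreal (\<bar>A \<omega>\<bar> powr s) \<partial>M) ^ Suc n"
    by (subst nn_integral_multc) (auto simp: Suc.IH mult.commute)
  finally show ?case
    by (simp add: partial_prod_def abs_mult powr_mult ennreal_mult' mult.commute prod.nat_ivl_Suc')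
qed

text \<open>By independence E|\<Pi>_n|^s is the n-th power of E|A|^s, so the sequence of roots is
  constant from n = 1 on. Only the roots of 0 and \<infinity> call for separate treatment.\<close>

lemma moment_growth_eq:
  "moment_growth M As s = (\<integral>\<^sup>+ \<omega>. ennreal (\<bar>A \<omega>\<bar> powr s) \<partial>M)"
proof -
  let ?m = "\<integral>\<^sup>+ \<omega>. ennreal (\<bar>A \<omega>\<bar> powr s) \<partial>M"
  have "ennreal_powr (?m ^ n) (1 / real n) = ?m" if "n \<ge> 1" for n
  proof (cases "?m = \<infinity>")
    case True
    with that show ?thesis by (simp add: ennreal_powr_def top_power_ennreal)
  next
    case False
    then obtain r where r: "r \<ge> 0" "?m = ennreal r" by (cases ?m) auto
    have "(r ^ n) powr (1 / real n) = r"
    proof (cases "r = 0")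
      case True
      with that show ?thesis by (simp add: zero_power)
    next
      case False
      with r have "r > 0" by simp
      with that show ?thesis by (simp add: powr_realpow[symmetric] powr_powr)
    qed
    with r show ?thesis by (simp add: ennreal_powr_def ennreal_power)
  qed
  then have "(\<lambda>n. ennreal_powr (\<integral>\<^sup>+ \<omega>. ennreal (\<bar>partial_prod As n \<omega>\<bar> powr s) \<partial>M) (1 / real n)) \<longlonglongrightarrow> ?m"
    by (intro tendsto_eventually) (auto simp: nn_integral_partial_prod eventually_sequentially)
  then show ?thesis unfolding moment_growth_def by (rule limI)
qed

end

section \<open>Lyapunov functions\<close>

text \<open>Isolates what the Lyapunov estimates use. In the theorem the moment of B comes from the
  tail hypothesis at x = 0, and the nontriviality of |A| from an exponent with h_A > 1.\<close>

locale kesten_map = random_affine_map +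
  fixes \<alpha> :: real
  assumes two_le_alpha: "2 \<le> \<alpha>"
    and A_moment: "(\<integral>\<^sup>+ \<omega>. ennreal (\<bar>A \<omega>\<bar> powr \<alpha>) \<partial>M) = 1"
    and B_moment: "(\<integral>\<^sup>+ \<omega>. ennreal (\<bar>B \<omega>\<bar> powr \<alpha>) \<partial>M) < \<infinity>"
    and A_nontrivial: "\<not> (AE \<omega> in M. \<bar>A \<omega>\<bar> = 1)"
begin

section \<open>Moments of |A| and of |Ax + B|\<close>

lemma integrable_A_powr: "integrable M (\<lambda>\<omega>. \<bar>A \<omega>\<bar> powr \<alpha>)"
  by (rule integrableI_nonneg) (auto simp: A_moment)

lemma expectation_A_powr: "expectation (\<lambda>\<omega>. \<bar>A \<omega>\<bar> powr \<alpha>) = 1"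
  by (subst integral_eq_nn_integral) (auto simp: A_moment)

lemma integrable_B_powr: "integrable M (\<lambda>\<omega>. \<bar>B \<omega>\<bar> powr \<alpha>)"
  by (rule integrableI_nonneg) (use B_moment in auto)

lemma integrable_powr_less:
  assumes [measurable]: "Y \<in> borel_measurable M" and int: "integrable M (\<lambda>\<omega>. \<bar>Y \<omega> :: real\<bar> powr \<alpha>)"
    and s: "0 < s" "s \<le> \<alpha>"
  shows "integrable M (\<lambda>\<omega>. \<bar>Y \<omega>\<bar> powr s)"
proof (rule Bochner_Integration.integrable_bound)
  show "integrable M (\<lambda>\<omega>. 1 + \<bar>Y \<omega>\<bar> powr \<alpha>)" using int by auto
  show "AE \<omega> in M. norm (\<bar>Y \<omega>\<bar> powr s) \<le> norm (1 + \<bar>Y \<omega>\<bar> powr \<alpha>)"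
  proof (rule AE_I2)
    fix \<omega>
    show "norm (\<bar>Y \<omega>\<bar> powr s) \<le> norm (1 + \<bar>Y \<omega>\<bar> powr \<alpha>)"
    proof (cases "\<bar>Y \<omega>\<bar> \<le> 1")
      case True
      then have "\<bar>Y \<omega>\<bar> powr s \<le> 1" using s by (intro powr_le1) auto
      then show ?thesis by (simp add: add_increasing2)
    next
      case False
      then have "\<bar>Y \<omega>\<bar> powr s \<le> \<bar>Y \<omega>\<bar> powr \<alpha>" using s by (intro powr_mono) auto
      then show ?thesis by simp
    qed
  qed
qed measurable

text \<open>Integrating the strict weighted inequality gives E|A|^s \<le> s/\<alpha> + (1 -
  s/\<alpha>) = 1. Equality would make the nonnegative integrand \<open>?D\<close> vanish almost
  surely, which happens only where |A| = 1.\<close>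

lemma A_moment_less_one:
  assumes s: "0 < s" "s < \<alpha>"
  shows "expectation (\<lambda>\<omega>. \<bar>A \<omega>\<bar> powr s) < 1"
proof (rule ccontr)
  assume *: "\<not> ?thesis"
  have int: "integrable M (\<lambda>\<omega>. \<bar>A \<omega>\<bar> powr s)"
    using s by (intro integrable_powr_less[OF _ integrable_A_powr]) auto
  let ?D = "\<lambda>\<omega>. s / \<alpha> * \<bar>A \<omega>\<bar> powr \<alpha> + (1 - s / \<alpha>) - \<bar>A \<omega>\<bar> powr s"
  have pos: "0 < ?D \<omega>" if "\<bar>A \<omega>\<bar> \<noteq> 1" for \<omega>
    using powr_weighted_strict[of s \<alpha> "\<bar>A \<omega>\<bar>"] s that by simp
  then have nonneg: "0 \<le> ?D \<omega>" for \<omega>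
    by (cases "\<bar>A \<omega>\<bar> = 1") (auto intro: less_imp_le)
  have intD: "integrable M ?D" using int integrable_A_powr by auto
  have "expectation ?D = s / \<alpha> + (1 - s / \<alpha>) - expectation (\<lambda>\<omega>. \<bar>A \<omega>\<bar> powr s)"
    using int integrable_A_powr by (simp add: expectation_A_powr prob_space)
  with * have "expectation ?D \<le> 0" by simp
  moreover have "0 \<le> expectation ?D" using nonneg by (intro integral_nonneg_AE) auto
  ultimately have "expectation ?D = 0" by simp
  then have "AE \<omega> in M. ?D \<omega> = 0"
    using integral_nonneg_eq_0_iff_AE[OF intD] nonneg by auto
  then have "AE \<omega> in M. \<bar>A \<omega>\<bar> = 1"
    by eventually_elim (use pos in fastforce)
  with A_nontrivial show False by simp
qed

lemma integrable_sum_powr: "integrable M (\<lambda>\<omega>. (\<bar>A \<omega>\<bar> + \<bar>B \<omega>\<bar>) powr \<alpha>)"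
proof (rule Bochner_Integration.integrable_bound)
  show "integrable M (\<lambda>\<omega>. 2 powr \<alpha> * (\<bar>A \<omega>\<bar> powr \<alpha> + \<bar>B \<omega>\<bar> powr \<alpha>))"
    using integrable_A_powr integrable_B_powr by auto
  show "AE \<omega> in M. norm ((\<bar>A \<omega>\<bar> + \<bar>B \<omega>\<bar>) powr \<alpha>) \<le> norm (2 powr \<alpha> * (\<bar>A \<omega>\<bar> powr \<alpha> + \<bar>B \<omega>\<bar> powr \<alpha>))"
    using two_le_alpha by (auto intro!: AE_I2 powr_add_le_two)
qed measurable

lemma affine_le: "\<bar>A \<omega> * x\<bar> + \<bar>B \<omega>\<bar> \<le> (\<bar>A \<omega>\<bar> + \<bar>B \<omega>\<bar>) * (1 + \<bar>x\<bar>)"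
  by (simp add: abs_mult algebra_simps)

lemma integrable_affine_powr: "integrable M (\<lambda>\<omega>. \<bar>A \<omega> * x + B \<omega>\<bar> powr \<alpha>)"
proof (rule Bochner_Integration.integrable_bound)
  show "integrable M (\<lambda>\<omega>. (\<bar>A \<omega>\<bar> + \<bar>B \<omega>\<bar>) powr \<alpha> * (1 + \<bar>x\<bar>) powr \<alpha>)"
    using integrable_sum_powr by auto
  have "\<bar>A \<omega> * x + B \<omega>\<bar> powr \<alpha> \<le> ((\<bar>A \<omega>\<bar> + \<bar>B \<omega>\<bar>) * (1 + \<bar>x\<bar>)) powr \<alpha>" for \<omega>
    using affine_le[of \<omega> x] two_le_alpha by (intro powr_mono2) auto
  then show "AE \<omega> in M. norm (\<bar>A \<omega> * x + B \<omega>\<bar> powr \<alpha>) \<le> norm ((\<bar>A \<omega>\<bar> + \<bar>B \<omega>\<bar>) powr \<alpha> * (1 + \<bar>x\<bar>) powr \<alpha>)"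
    by (intro AE_I2) (simp add: powr_mult)
qed measurable

lemma expectation_affine_powr_alpha:
  obtains C where "0 \<le> C"
    "\<And>x. \<bar>expectation (\<lambda>\<omega>. \<bar>A \<omega> * x + B \<omega>\<bar> powr \<alpha>) - \<bar>x\<bar> powr \<alpha>\<bar> \<le> C * (1 + \<bar>x\<bar> powr (\<alpha> - 1))"
proof
  let ?S = "\<lambda>\<omega>. \<bar>A \<omega>\<bar> + \<bar>B \<omega>\<bar>"
  let ?m = "expectation (\<lambda>\<omega>. ?S \<omega> powr \<alpha>)"
  let ?C = "\<alpha> * ?m * 2 powr (\<alpha> - 1)"
  have m: "0 \<le> ?m" by (intro integral_nonneg_AE) auto
  then show "0 \<le> ?C" using two_le_alpha by simp
  fix x :: real
  have pt: "\<bar>\<bar>A \<omega> * x + B \<omega>\<bar> powr \<alpha> - \<bar>A \<omega> * x\<bar> powr \<alpha>\<bar> \<le> \<alpha> * ?S \<omega> powr \<alpha> * (1 + \<bar>x\<bar>) powr (\<alpha> - 1)" for \<omega>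
  proof -
    have "\<bar>\<bar>A \<omega> * x + B \<omega>\<bar> powr \<alpha> - \<bar>A \<omega> * x\<bar> powr \<alpha>\<bar>
        \<le> \<alpha> * \<bar>B \<omega>\<bar> * (\<bar>A \<omega> * x\<bar> + \<bar>B \<omega>\<bar>) powr (\<alpha> - 1)"
      using two_le_alpha by (intro abs_powr_diff_le) auto
    \<comment> \<open>Enlarging |B| to S = |A| + |B| replaces mixed moments of A and B by the single
      moment E S^\<alpha>, and \<open>affine_le\<close> separates S from x.\<close>
    also have "\<dots> \<le> \<alpha> * ?S \<omega> * (?S \<omega> * (1 + \<bar>x\<bar>)) powr (\<alpha> - 1)"
      using two_le_alpha affine_le[of \<omega> x] by (intro mult_mono powr_mono2) auto
    also have "\<dots> = \<alpha> * (?S \<omega> * ?S \<omega> powr (\<alpha> - 1)) * (1 + \<bar>x\<bar>) powr (\<alpha> - 1)"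
      by (simp add: powr_mult)
    also have "?S \<omega> * ?S \<omega> powr (\<alpha> - 1) = ?S \<omega> powr \<alpha>"
      by (cases "?S \<omega> = 0") (auto simp: powr_mult_base)
    finally show ?thesis .
  qed
  have intA: "integrable M (\<lambda>\<omega>. \<bar>A \<omega> * x\<bar> powr \<alpha>)"
    using integrable_A_powr by (simp add: abs_mult powr_mult)
  have EA: "expectation (\<lambda>\<omega>. \<bar>A \<omega> * x\<bar> powr \<alpha>) = \<bar>x\<bar> powr \<alpha>"
    by (simp add: abs_mult powr_mult expectation_A_powr)
  have "\<bar>expectation (\<lambda>\<omega>. \<bar>A \<omega> * x + B \<omega>\<bar> powr \<alpha>) - \<bar>x\<bar> powr \<alpha>\<bar>
      = \<bar>expectation (\<lambda>\<omega>. \<bar>A \<omega> * x + B \<omega>\<bar> powr \<alpha> - \<bar>A \<omega> * x\<bar> powr \<alpha>)\<bar>"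
    using intA integrable_affine_powr by (simp add: EA)
  also have "\<dots> \<le> expectation (\<lambda>\<omega>. \<bar>\<bar>A \<omega> * x + B \<omega>\<bar> powr \<alpha> - \<bar>A \<omega> * x\<bar> powr \<alpha>\<bar>)"
    by (rule integral_abs_bound)
  also have "\<dots> \<le> expectation (\<lambda>\<omega>. \<alpha> * ?S \<omega> powr \<alpha> * (1 + \<bar>x\<bar>) powr (\<alpha> - 1))"
    using pt intA integrable_affine_powr integrable_sum_powr by (intro integral_mono) auto
  also have "\<dots> = \<alpha> * ?m * (1 + \<bar>x\<bar>) powr (\<alpha> - 1)" by simp
  also have "\<dots> \<le> \<alpha> * ?m * (2 powr (\<alpha> - 1) * (1 powr (\<alpha> - 1) + \<bar>x\<bar> powr (\<alpha> - 1)))"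
    using m two_le_alpha by (intro mult_left_mono powr_add_le_two) auto
  finally show "\<bar>expectation (\<lambda>\<omega>. \<bar>A \<omega> * x + B \<omega>\<bar> powr \<alpha>) - \<bar>x\<bar> powr \<alpha>\<bar> \<le> ?C * (1 + \<bar>x\<bar> powr (\<alpha> - 1))"
    by (simp add: mult.assoc)
qed

lemma integrable_affine_powr_less:
  "0 < s \<Longrightarrow> s \<le> \<alpha> \<Longrightarrow> integrable M (\<lambda>\<omega>. \<bar>A \<omega> * x + B \<omega>\<bar> powr s)"
  by (rule integrable_powr_less[OF _ integrable_affine_powr]) auto

lemma expectation_affine_powr_contracting:
  assumes s: "0 < s" "s < \<alpha>"
  obtains \<rho> C where "\<rho> < 1" "0 \<le> \<rho>" "0 \<le> C"
    "\<And>x. expectation (\<lambda>\<omega>. \<bar>A \<omega> * x + B \<omega>\<bar> powr s) \<le> \<rho> * \<bar>x\<bar> powr s + C"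
proof -
  let ?h = "expectation (\<lambda>\<omega>. \<bar>A \<omega>\<bar> powr s)"
  have h: "?h < 1" "0 \<le> ?h" using A_moment_less_one[OF s] by (auto intro: integral_nonneg_AE)
  \<comment> \<open>Half of the gap to 1 is spent on the factor from adding B: with h = E|A|^s < 1,
    (1 + e) h \<le> h + e = (1 + h)/2 < 1.\<close>
  define e where "e = (1 - ?h) / 2"
  have e: "0 < e" using h by (simp add: e_def)
  obtain D where D: "0 \<le> D"
    "\<And>a b :: real. 0 \<le> a \<Longrightarrow> 0 \<le> b \<Longrightarrow> (a + b) powr s \<le> (1 + e) * a powr s + D * b powr s"
    using powr_add_le[OF s(1) e] by blast
  let ?b = "expectation (\<lambda>\<omega>. \<bar>B \<omega>\<bar> powr s)"
  have intA: "integrable M (\<lambda>\<omega>. \<bar>A \<omega>\<bar> powr s)" and intB: "integrable M (\<lambda>\<omega>. \<bar>B \<omega>\<bar> powr s)"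
    using s integrable_powr_less[OF _ integrable_A_powr] integrable_powr_less[OF _ integrable_B_powr]
    by auto
  show thesis
  proof
    have "(1 + e) * ?h \<le> ?h + e * 1" using h e by (simp add: distrib_right mult_left_mono)
    then show "(1 + e) * ?h < 1" using h by (simp add: e_def field_simps)
    show "0 \<le> (1 + e) * ?h" using h e by simp
    show "0 \<le> D * ?b" using D by (auto intro!: mult_nonneg_nonneg integral_nonneg_AE)
    fix x :: real
    have "expectation (\<lambda>\<omega>. \<bar>A \<omega> * x + B \<omega>\<bar> powr s)
        \<le> expectation (\<lambda>\<omega>. (1 + e) * (\<bar>A \<omega>\<bar> powr s * \<bar>x\<bar> powr s) + D * \<bar>B \<omega>\<bar> powr s)"
    proof (rule integral_mono)
      show "integrable M (\<lambda>\<omega>. \<bar>A \<omega> * x + B \<omega>\<bar> powr s)"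
        using s by (intro integrable_affine_powr_less) auto
      show "integrable M (\<lambda>\<omega>. (1 + e) * (\<bar>A \<omega>\<bar> powr s * \<bar>x\<bar> powr s) + D * \<bar>B \<omega>\<bar> powr s)"
        using intA intB by auto
      fix \<omega>
      have "\<bar>A \<omega> * x + B \<omega>\<bar> powr s \<le> (\<bar>A \<omega> * x\<bar> + \<bar>B \<omega>\<bar>) powr s"
        using s by (intro powr_mono2) auto
      also have "\<dots> \<le> (1 + e) * \<bar>A \<omega> * x\<bar> powr s + D * \<bar>B \<omega>\<bar> powr s" by (rule D) auto
      finally show "\<bar>A \<omega> * x + B \<omega>\<bar> powr s
          \<le> (1 + e) * (\<bar>A \<omega>\<bar> powr s * \<bar>x\<bar> powr s) + D * \<bar>B \<omega>\<bar> powr s"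
        by (simp add: abs_mult powr_mult)
    qed
    also have "\<dots> = (1 + e) * ?h * \<bar>x\<bar> powr s + D * ?b"
      using intA intB by simp
    finally show "expectation (\<lambda>\<omega>. \<bar>A \<omega> * x + B \<omega>\<bar> powr s) \<le> (1 + e) * ?h * \<bar>x\<bar> powr s + D * ?b" .
  qed
qed

lemma step_upper_lyapunov:
  obtains K C where "0 \<le> K" "0 \<le> C"
    "\<And>x. step (\<lambda>x. ennreal (\<bar>x\<bar> powr \<alpha> + K * \<bar>x\<bar> powr (\<alpha> - 1))) x
      \<le> ennreal (\<bar>x\<bar> powr \<alpha> + K * \<bar>x\<bar> powr (\<alpha> - 1) + C)"
proof -
  obtain C1 where C1: "0 \<le> C1"
    "\<And>x. \<bar>expectation (\<lambda>\<omega>. \<bar>A \<omega> * x + B \<omega>\<bar> powr \<alpha>) - \<bar>x\<bar> powr \<alpha>\<bar> \<le> C1 * (1 + \<bar>x\<bar> powr (\<alpha> - 1))"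
    by (rule expectation_affine_powr_alpha) blast
  obtain \<rho> C2 where C2: "\<rho> < 1" "0 \<le> \<rho>" "0 \<le> C2"
    "\<And>x. expectation (\<lambda>\<omega>. \<bar>A \<omega> * x + B \<omega>\<bar> powr (\<alpha> - 1)) \<le> \<rho> * \<bar>x\<bar> powr (\<alpha> - 1) + C2"
    by (rule expectation_affine_powr_contracting[of "\<alpha> - 1"]) (use two_le_alpha in auto)
  \<comment> \<open>Solves C1 + K \<rho> = K: the error C1 |x|^(\<alpha>-1) is paid by the
    contraction of the second term, and the function is reproduced up to a constant.\<close>
  define K where "K = C1 / (1 - \<rho>)"
  have K: "0 \<le> K" "C1 + K * \<rho> = K" using C1 C2 by (auto simp: K_def field_simps)
  show thesis
  proof
    show "0 \<le> K" by fact
    show "0 \<le> C1 + K * C2" using C1 C2 K by auto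
    fix x :: real
    have int: "integrable M (\<lambda>\<omega>. \<bar>A \<omega> * x + B \<omega>\<bar> powr (\<alpha> - 1))"
      using two_le_alpha by (intro integrable_affine_powr_less) auto
    have "step (\<lambda>x. ennreal (\<bar>x\<bar> powr \<alpha> + K * \<bar>x\<bar> powr (\<alpha> - 1))) x
      = ennreal (expectation (\<lambda>\<omega>. \<bar>A \<omega> * x + B \<omega>\<bar> powr \<alpha> + K * \<bar>A \<omega> * x + B \<omega>\<bar> powr (\<alpha> - 1)))"
      unfolding step_def using int integrable_affine_powr K by (intro nn_integral_eq_integral) auto
    also have "expectation (\<lambda>\<omega>. \<bar>A \<omega> * x + B \<omega>\<bar> powr \<alpha> + K * \<bar>A \<omega> * x + B \<omega>\<bar> powr (\<alpha> - 1))
      = expectation (\<lambda>\<omega>. \<bar>A \<omega> * x + B \<omega>\<bar> powr \<alpha>) + K * expectation (\<lambda>\<omega>. \<bar>A \<omega> * x + B \<omega>\<bar> powr (\<alpha> - 1))"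
      using int integrable_affine_powr by simp
    also have "\<dots> \<le> (\<bar>x\<bar> powr \<alpha> + C1 * (1 + \<bar>x\<bar> powr (\<alpha> - 1))) + K * (\<rho> * \<bar>x\<bar> powr (\<alpha> - 1) + C2)"
    proof (rule add_mono)
      show "expectation (\<lambda>\<omega>. \<bar>A \<omega> * x + B \<omega>\<bar> powr \<alpha>) \<le> \<bar>x\<bar> powr \<alpha> + C1 * (1 + \<bar>x\<bar> powr (\<alpha> - 1))"
        using C1(2)[of x] by linarith
      show "K * expectation (\<lambda>\<omega>. \<bar>A \<omega> * x + B \<omega>\<bar> powr (\<alpha> - 1)) \<le> K * (\<rho> * \<bar>x\<bar> powr (\<alpha> - 1) + C2)"
        using C2(4)[of x] K by (intro mult_left_mono)
    qed
    also have "\<dots> = \<bar>x\<bar> powr \<alpha> + (C1 + K * \<rho>) * \<bar>x\<bar> powr (\<alpha> - 1) + (C1 + K * C2)"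
      by (simp add: algebra_simps)
    finally show "step (\<lambda>x. ennreal (\<bar>x\<bar> powr \<alpha> + K * \<bar>x\<bar> powr (\<alpha> - 1))) x
      \<le> ennreal (\<bar>x\<bar> powr \<alpha> + K * \<bar>x\<bar> powr (\<alpha> - 1) + (C1 + K * C2))"
      unfolding K(2) by (simp add: ennreal_leI)
  qed
qed

text \<open>Cutting V at a height v and taking the positive part can only raise the mean after one
  step, so where the result is positive it inherits the drift of V; the height is chosen to exclude
  the region where that drift is too small.\<close>

lemma step_subharmonic:
  obtains g :: "real \<Rightarrow> real" and r where "0 \<le> r" "g \<in> borel_measurable borel"
    "\<And>x. 0 \<le> g x" "\<And>x. g x \<le> \<bar>x\<bar> powr \<alpha>"
    "\<And>x. 0 < g x \<Longrightarrow> ennreal (g x + 1) \<le> step (\<lambda>x. ennreal (g x)) x"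
    "\<And>x. r \<le> \<bar>x\<bar> \<Longrightarrow> 1 \<le> g x"
proof -
  obtain C1 where C1: "0 \<le> C1"
    "\<And>x. \<bar>expectation (\<lambda>\<omega>. \<bar>A \<omega> * x + B \<omega>\<bar> powr \<alpha>) - \<bar>x\<bar> powr \<alpha>\<bar> \<le> C1 * (1 + \<bar>x\<bar> powr (\<alpha> - 1))"
    by (rule expectation_affine_powr_alpha) blast
  obtain \<rho> C2 where C2: "\<rho> < 1" "0 \<le> \<rho>" "0 \<le> C2"
    "\<And>x. expectation (\<lambda>\<omega>. \<bar>A \<omega> * x + B \<omega>\<bar> powr (\<alpha> - 1)) \<le> \<rho> * \<bar>x\<bar> powr (\<alpha> - 1) + C2"
    by (rule expectation_affine_powr_contracting[of "\<alpha> - 1"]) (use two_le_alpha in auto)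
  \<comment> \<open>Solves K - K \<rho> = C1 + 1, one more than what cancels the error, so that a
    gain of |x|^(\<alpha>-1) remains in \<open>drift\<close>.\<close>
  define K where "K = (C1 + 1) / (1 - \<rho>)"
  have "K * (1 - \<rho>) = C1 + 1" using C2 by (simp add: K_def)
  then have K: "0 \<le> K" "K - K * \<rho> = C1 + 1" using C1 C2 by (auto simp: K_def right_diff_distrib)
  define V where "V x = \<bar>x\<bar> powr \<alpha> - K * \<bar>x\<bar> powr (\<alpha> - 1)" for x :: real
  \<comment> \<open>From radius l on, the gain |x|^(\<alpha>-1) exceeds the constant loss C1 + K C2
    by at least 1. As V x \<le> |x|^\<alpha>, the height v = l^\<alpha> guarantees that V x > v
    occurs only for |x| \<ge> l.\<close>
  define l where "l = (C1 + K * C2 + 1) powr (1 / (\<alpha> - 1))"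
  define v where "v = l powr \<alpha>"
  define g where "g x = max 0 (V x - v)" for x
  have [measurable]: "V \<in> borel_measurable borel" unfolding V_def[abs_def] by measurable
  have l0: "0 \<le> l" and v0: "0 \<le> v" by (auto simp: l_def v_def)
  have l: "l powr (\<alpha> - 1) = C1 + K * C2 + 1"
    using two_le_alpha C1 C2 K by (simp add: l_def powr_powr)
  have intV: "integrable M (\<lambda>\<omega>. V (A \<omega> * x + B \<omega>))" for x
    unfolding V_def using integrable_affine_powr integrable_affine_powr_less[of "\<alpha> - 1"] two_le_alpha
    by auto
  have drift: "V x + \<bar>x\<bar> powr (\<alpha> - 1) - (C1 + K * C2) \<le> expectation (\<lambda>\<omega>. V (A \<omega> * x + B \<omega>))" for x
  proof -
    have "K * expectation (\<lambda>\<omega>. \<bar>A \<omega> * x + B \<omega>\<bar> powr (\<alpha> - 1)) \<le> K * (\<rho> * \<bar>x\<bar> powr (\<alpha> - 1) + C2)"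
      using C2(4)[of x] K by (intro mult_left_mono)
    moreover have "\<bar>x\<bar> powr \<alpha> - C1 * (1 + \<bar>x\<bar> powr (\<alpha> - 1)) \<le> expectation (\<lambda>\<omega>. \<bar>A \<omega> * x + B \<omega>\<bar> powr \<alpha>)"
      using C1(2)[of x] by linarith
    moreover have "expectation (\<lambda>\<omega>. V (A \<omega> * x + B \<omega>)) = expectation (\<lambda>\<omega>. \<bar>A \<omega> * x + B \<omega>\<bar> powr \<alpha>)
        - K * expectation (\<lambda>\<omega>. \<bar>A \<omega> * x + B \<omega>\<bar> powr (\<alpha> - 1))"
      unfolding V_def using integrable_affine_powr integrable_affine_powr_less[of "\<alpha> - 1"] two_le_alpha
      by simp
    moreover have "V x + \<bar>x\<bar> powr (\<alpha> - 1) - (C1 + K * C2)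
       = \<bar>x\<bar> powr \<alpha> - (K - 1) * \<bar>x\<bar> powr (\<alpha> - 1) - C1 - K * C2" by (simp add: V_def algebra_simps)
    moreover have "K - 1 = C1 + K * \<rho>" using K by simp
    ultimately show ?thesis by (simp add: algebra_simps)
  qed
  show thesis
  proof
    show "0 \<le> 2 + K + v" using K v0 by simp
    show "g \<in> borel_measurable borel" unfolding g_def[abs_def] by measurable
    show "0 \<le> g x" for x by (simp add: g_def)
    show "g x \<le> \<bar>x\<bar> powr \<alpha>" for x
    proof -
      have "V x \<le> \<bar>x\<bar> powr \<alpha>" using K by (simp add: V_def)
      with v0 show ?thesis by (simp add: g_def)
    qed
    show "ennreal (g x + 1) \<le> step (\<lambda>x. ennreal (g x)) x" if "0 < g x" for x
    proof -
      have V: "v < V x" and gV: "g x = V x - v" using that by (auto simp: g_def)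
      have "l \<le> \<bar>x\<bar>"
      proof (rule ccontr)
        assume "\<not> l \<le> \<bar>x\<bar>"
        then have "\<bar>x\<bar> powr \<alpha> \<le> v"
          unfolding v_def using two_le_alpha by (intro powr_mono2) auto
        moreover have "V x \<le> \<bar>x\<bar> powr \<alpha>" using K by (simp add: V_def)
        ultimately show False using V by simp
      qed
      then have "l powr (\<alpha> - 1) \<le> \<bar>x\<bar> powr (\<alpha> - 1)"
        using l0 two_le_alpha by (intro powr_mono2) auto
      with drift[of x] l have "V x + 1 - v \<le> expectation (\<lambda>\<omega>. V (A \<omega> * x + B \<omega>)) - v" by simp
      also have "\<dots> = expectation (\<lambda>\<omega>. V (A \<omega> * x + B \<omega>) - v)"
        using intV by (simp add: prob_space)
      also have "\<dots> \<le> expectation (\<lambda>\<omega>. g (A \<omega> * x + B \<omega>))"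
        unfolding g_def using intV by (intro integral_mono integrable_max) auto
      finally have "ennreal (g x + 1) \<le> ennreal (expectation (\<lambda>\<omega>. g (A \<omega> * x + B \<omega>)))"
        using gV by (intro ennreal_leI) simp
      also have "\<dots> = step (\<lambda>x. ennreal (g x)) x"
        unfolding step_def g_def using intV
        by (intro nn_integral_eq_integral[symmetric] integrable_max) auto
      finally show ?thesis .
    qed
    show "1 \<le> g x" if x: "2 + K + v \<le> \<bar>x\<bar>" for x
    proof -
      have "1 \<le> \<bar>x\<bar> powr (\<alpha> - 1)"
        using x K v0 two_le_alpha by (intro ge_one_powr_ge_zero) auto
      \<comment> \<open>V x factors as |x|^(\<alpha>-1) (|x| - K); the radius 2 + K + v makes the
        factors at least 1 and 2 + v.\<close>
      then have "1 * (2 + v) \<le> \<bar>x\<bar> powr (\<alpha> - 1) * (\<bar>x\<bar> - K)"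
        using x v0 by (intro mult_mono) auto
      also have "\<dots> = V x"
        using x K v0 by (simp add: V_def powr_diff field_simps)
      finally show ?thesis by (simp add: g_def)
    qed
  qed
qed

section \<open>Iterates of the transition operator and the stationary law\<close>

lemma expectation_abs_A_less_one: "integrable M (\<lambda>\<omega>. \<bar>A \<omega>\<bar>)" "expectation (\<lambda>\<omega>. \<bar>A \<omega>\<bar>) < 1"
  using integrable_powr_less[of A 1] A_moment_less_one[of 1] integrable_A_powr two_le_alpha by auto

text \<open>Two starting points driven by the same pair have their distance multiplied by |A|, on
  average by E|A| < 1, so iteration flattens Lipschitz functions geometrically. The bound by 1 is
  carried along to keep \<open>enn2real\<close> faithful.\<close>

lemma step_iterate_lipschitz:
  assumes [measurable]: "f \<in> borel_measurable borel"
    and f: "\<And>x. 0 \<le> f x" "\<And>x. f x \<le> (1 :: real)" "\<And>x y. \<bar>f x - f y\<bar> \<le> \<bar>x - y\<bar>"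
  shows "(step ^^ n) (\<lambda>x. ennreal (f x)) x \<le> 1"
    and "\<bar>enn2real ((step ^^ n) (\<lambda>x. ennreal (f x)) x) - enn2real ((step ^^ n) (\<lambda>x. ennreal (f x)) y)\<bar>
      \<le> expectation (\<lambda>\<omega>. \<bar>A \<omega>\<bar>) ^ n * \<bar>x - y\<bar>"
proof (induction n arbitrary: x y)
  case 0
  {
    case 1
    show ?case using f by simp
  next
    case 2
    show ?case using f by simp
  }
next
  case (Suc n)
  let ?F = "\<lambda>x. (step ^^ n) (\<lambda>x. ennreal (f x)) x"
  let ?h = "expectation (\<lambda>\<omega>. \<bar>A \<omega>\<bar>)"
  {
    case 1
    have "step ?F x \<le> (\<integral>\<^sup>+ \<omega>. 1 \<partial>M)"
      unfolding step_def[of ?F] by (intro nn_integral_mono Suc)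
    then show ?case by (simp add: emeasure_space_1)
  next
    case 2
    have fin: "?F x < top" for x using Suc(1)[of x] by (rule le_less_trans) simp
    have int: "integrable M (\<lambda>\<omega>. enn2real (?F (A \<omega> * x + B \<omega>)))" for x
    proof (rule integrable_const_bound[where B = 1])
      show "AE \<omega> in M. norm (enn2real (?F (A \<omega> * x + B \<omega>))) \<le> 1"
        using Suc(1) by (auto intro!: enn2real_leI)
    qed measurable
    have eq: "enn2real (step ?F x) = expectation (\<lambda>\<omega>. enn2real (?F (A \<omega> * x + B \<omega>)))" for x
      unfolding step_def[of ?F] by (subst integral_eq_nn_integral) (auto simp: fin)
    have "\<bar>enn2real (step ?F x) - enn2real (step ?F y)\<bar>
        = \<bar>expectation (\<lambda>\<omega>. enn2real (?F (A \<omega> * x + B \<omega>)) - enn2real (?F (A \<omega> * y + B \<omega>)))\<bar>"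
      unfolding eq using int by simp
    also have "\<dots> \<le> expectation (\<lambda>\<omega>. \<bar>enn2real (?F (A \<omega> * x + B \<omega>)) - enn2real (?F (A \<omega> * y + B \<omega>))\<bar>)"
      by (rule integral_abs_bound)
    also have "\<dots> \<le> expectation (\<lambda>\<omega>. ?h ^ n * \<bar>x - y\<bar> * \<bar>A \<omega>\<bar>)"
    proof (rule integral_mono)
      show "integrable M (\<lambda>\<omega>. \<bar>enn2real (?F (A \<omega> * x + B \<omega>)) - enn2real (?F (A \<omega> * y + B \<omega>))\<bar>)"
        using int by auto
      show "integrable M (\<lambda>\<omega>. ?h ^ n * \<bar>x - y\<bar> * \<bar>A \<omega>\<bar>)"
        using expectation_abs_A_less_one by auto
      fix \<omega>
      have "\<bar>A \<omega> * x + B \<omega> - (A \<omega> * y + B \<omega>)\<bar> = \<bar>x - y\<bar> * \<bar>A \<omega>\<bar>"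
        by (simp add: abs_mult[symmetric] algebra_simps)
      with Suc(2)[of "A \<omega> * x + B \<omega>" "A \<omega> * y + B \<omega>"]
      show "\<bar>enn2real (?F (A \<omega> * x + B \<omega>)) - enn2real (?F (A \<omega> * y + B \<omega>))\<bar> \<le> ?h ^ n * \<bar>x - y\<bar> * \<bar>A \<omega>\<bar>"
        by (simp add: mult.assoc)
    qed
    also have "\<dots> = ?h ^ Suc n * \<bar>x - y\<bar>" by simp
    finally show ?case by simp
  }
qed

text \<open>The iterates share one mean q under \<nu> and become flat, so for large N their values
  on |x| \<le> r are at least q/2. The test function is positive exactly where |x| > r and, unlike
  the indicator of that set, is Lipschitz.\<close>

lemma step_iterate_bounded_below:
  assumes st: "stationary_distribution M A B \<nu>" and unbd: "\<not> bounded (measure_support \<nu>)"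
    and r: "0 \<le> r"
  obtains N c where "1 \<le> N" "0 < c"
    "\<And>x. \<bar>x\<bar> \<le> r \<Longrightarrow> ennreal c \<le> (step ^^ N) (\<lambda>x. ennreal (min 1 (max 0 (\<bar>x\<bar> - r)))) x"
proof -
  from st have "prob_space \<nu>" and sets [measurable_cong, simp]: "sets \<nu> = sets borel"
    by (auto simp: stationary_distribution_def)
  interpret \<nu>: prob_space \<nu> by fact
  let ?f = "\<lambda>x :: real. min 1 (max 0 (\<bar>x\<bar> - r))"
  let ?S = "\<lambda>n. (step ^^ n) (\<lambda>x. ennreal (?f x))"
  let ?F = "\<lambda>n x. enn2real (?S n x)"
  let ?h = "expectation (\<lambda>\<omega>. \<bar>A \<omega>\<bar>)"
  have h: "0 \<le> ?h" "?h < 1" using expectation_abs_A_less_one by (auto intro: integral_nonneg_AE)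
  have fm [measurable]: "?f \<in> borel_measurable borel" by measurable
  have flip: "\<bar>?f x - ?f y\<bar> \<le> \<bar>x - y\<bar>" for x y
    by (auto simp: min_def max_def)
  have le1: "?S n x \<le> 1" for n x
    by (rule step_iterate_lipschitz[OF _ _ _ flip]) auto
  have lip: "\<bar>?F n x - ?F n y\<bar> \<le> ?h ^ n * \<bar>x - y\<bar>" for n x y
    by (rule step_iterate_lipschitz[OF _ _ _ flip]) auto
  have F01: "0 \<le> ?F n x" "?F n x \<le> 1" for n x using le1 by (auto intro!: enn2real_leI)
  have fin: "?S n x < top" for n x using le1[of n x] by (rule le_less_trans) simp
  define q where "q = (\<integral>x. ?f x \<partial>\<nu>)"
  have intf: "integrable \<nu> ?f"
    by (rule \<nu>.integrable_const_bound[where B = 1]) auto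
  have intF: "integrable \<nu> (?F n)" for n
    by (rule \<nu>.integrable_const_bound[where B = 1]) (use F01 in auto)
  have qF: "(\<integral>x. ?F n x \<partial>\<nu>) = q" for n
  proof -
    have "(\<integral>x. ?F n x \<partial>\<nu>) = enn2real (\<integral>\<^sup>+ x. ?S n x \<partial>\<nu>)"
      by (subst integral_eq_nn_integral) (auto simp: fin)
    also have "(\<integral>\<^sup>+ x. ?S n x \<partial>\<nu>) = (\<integral>\<^sup>+ x. ennreal (?f x) \<partial>\<nu>)"
      by (rule stationary_step_iterate[OF st]) measurable
    also have "enn2real \<dots> = q" unfolding q_def by (subst integral_eq_nn_integral) auto
    finally show ?thesis .
  qed
  \<comment> \<open>Were q = 0, the open set |x| > r would be null for \<nu>, yet it contains a
    point of the unbounded support.\<close>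
  have "0 < q"
  proof (rule ccontr)
    assume "\<not> 0 < q"
    moreover have "0 \<le> q" unfolding q_def by (intro integral_nonneg_AE) auto
    ultimately have "q = 0" by simp
    then have "AE x in \<nu>. ?f x = 0"
      unfolding q_def using integral_nonneg_eq_0_iff_AE[OF intf] by auto
    then have "AE x in \<nu>. x \<notin> {x. r < \<bar>x\<bar>}" by eventually_elim auto
    then have null: "emeasure \<nu> {x. r < \<bar>x\<bar>} = 0"
      by (subst (asm) AE_iff_measurable[of "{x. r < \<bar>x\<bar>}"]) (auto simp: sets_eq_imp_space_eq[OF sets])
    from unbd obtain z where z: "z \<in> measure_support \<nu>" "r < \<bar>z\<bar>"
      unfolding bounded_real by (auto simp: not_le)
    have "open {x :: real. r < \<bar>x\<bar>}" by (intro open_Collect_less continuous_intros)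
    with z have "0 < emeasure \<nu> {x. r < \<bar>x\<bar>}" by (auto simp: measure_support_def)
    with null show False by simp
  qed
  \<comment> \<open>Bounds the difference of the n-th iterate at x and y uniformly in |x| \<le> r.
    The cap at 1, legitimate for values in [0, 1], supplies a dominating function whatever the tails
    of \<nu>.\<close>
  let ?e = "\<lambda>n y. min 1 (?h ^ n * (r + \<bar>y\<bar>))"
  have e01: "0 \<le> ?e n y" "?e n y \<le> 1" for n y using h r by auto
  have "(\<lambda>n. \<integral>y. ?e n y \<partial>\<nu>) \<longlonglongrightarrow> (\<integral>y. 0 \<partial>\<nu>)"
  proof (rule integral_dominated_convergence[where w = "\<lambda>_. 1"])
    show "AE y in \<nu>. (\<lambda>n. ?e n y) \<longlonglongrightarrow> 0"
    proof (rule AE_I2)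
      fix y
      have "(\<lambda>n. min 1 (?h ^ n * (r + \<bar>y\<bar>))) \<longlonglongrightarrow> min 1 (0 * (r + \<bar>y\<bar>))"
        using h by (intro tendsto_intros LIMSEQ_power_zero) auto
      then show "(\<lambda>n. ?e n y) \<longlonglongrightarrow> 0" by simp
    qed
    show "AE y in \<nu>. norm (?e n y) \<le> 1" for n using e01 by auto
  qed auto
  then have "eventually (\<lambda>n. (\<integral>y. ?e n y \<partial>\<nu>) < q / 2) sequentially"
    using \<open>0 < q\<close> by (intro order_tendstoD) auto
  then obtain N where N: "1 \<le> N" "(\<integral>y. ?e N y \<partial>\<nu>) < q / 2"
    unfolding eventually_sequentially by (metis le_add1 le_add2)
  show thesis
  proof
    show "1 \<le> N" "0 < q / 2" using N \<open>0 < q\<close> by auto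
    fix x assume x: "\<bar>x\<bar> \<le> r"
    have inte: "integrable \<nu> (?e N)"
      by (rule \<nu>.integrable_const_bound[where B = 1]) (use e01 in auto)
    have "q - (\<integral>y. ?e N y \<partial>\<nu>) = (\<integral>y. ?F N y - ?e N y \<partial>\<nu>)"
      using intF inte by (simp add: qF)
    also have "\<dots> \<le> (\<integral>y. ?F N x \<partial>\<nu>)"
    proof (rule integral_mono)
      fix y
      have "?h ^ N * \<bar>x - y\<bar> \<le> ?h ^ N * (r + \<bar>y\<bar>)"
        using x h by (intro mult_left_mono) auto
      with lip[of N x y] F01[of N x] F01[of N y] show "?F N y - ?e N y \<le> ?F N x"
        by linarith
    qed (use intF inte in auto)
    also have "\<dots> = ?F N x" by (simp add: \<nu>.prob_space)
    finally have "q / 2 \<le> ?F N x" using N by simp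
    then show "ennreal (q / 2) \<le> ?S N x"
      using fin[of N x] by (metis ennreal_enn2real ennreal_leI)
  qed
qed

text \<open>One step enlarges 1 + |x|^\<alpha> by at most a constant factor. This keeps a finite sum
  of iterates of order |x|^\<alpha>.\<close>

lemma step_iterate_powr_bound:
  obtains C where "0 \<le> C" "\<And>x. (step ^^ n) (\<lambda>x. ennreal (1 + \<bar>x\<bar> powr \<alpha>)) x \<le> ennreal (C * (1 + \<bar>x\<bar> powr \<alpha>))"
proof -
  obtain C1 where C1: "0 \<le> C1"
    "\<And>x. \<bar>expectation (\<lambda>\<omega>. \<bar>A \<omega> * x + B \<omega>\<bar> powr \<alpha>) - \<bar>x\<bar> powr \<alpha>\<bar> \<le> C1 * (1 + \<bar>x\<bar> powr (\<alpha> - 1))"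
    by (rule expectation_affine_powr_alpha) blast
  let ?g = "\<lambda>x :: real. ennreal (1 + \<bar>x\<bar> powr \<alpha>)"
  let ?D = "1 + 2 * C1"
  have one: "step ?g x \<le> ennreal (?D * (1 + \<bar>x\<bar> powr \<alpha>))" for x
  proof -
    have "\<bar>x\<bar> powr (\<alpha> - 1) \<le> 1 + \<bar>x\<bar> powr \<alpha>"
    proof (cases "\<bar>x\<bar> \<le> 1")
      case True
      then have "\<bar>x\<bar> powr (\<alpha> - 1) \<le> 1" using two_le_alpha by (intro powr_le1) auto
      then show ?thesis by (simp add: add_increasing2)
    next
      case False
      then have "\<bar>x\<bar> powr (\<alpha> - 1) \<le> \<bar>x\<bar> powr \<alpha>" by (intro powr_mono) auto
      then show ?thesis by simp
    qed
    moreover have "1 + u \<le> 2 * (1 + w)" if "u \<le> 1 + w" "0 \<le> w" for u w :: real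
      using that by simp
    ultimately have "1 + \<bar>x\<bar> powr (\<alpha> - 1) \<le> 2 * (1 + \<bar>x\<bar> powr \<alpha>)"
      using powr_ge_zero by blast
    then have "C1 * (1 + \<bar>x\<bar> powr (\<alpha> - 1)) \<le> C1 * (2 * (1 + \<bar>x\<bar> powr \<alpha>))"
      using C1(1) by (intro mult_left_mono)
    with C1(2)[of x] have "1 + expectation (\<lambda>\<omega>. \<bar>A \<omega> * x + B \<omega>\<bar> powr \<alpha>) \<le> ?D * (1 + \<bar>x\<bar> powr \<alpha>)"
      by (simp add: algebra_simps)
    moreover have "step ?g x = ennreal (expectation (\<lambda>\<omega>. 1 + \<bar>A \<omega> * x + B \<omega>\<bar> powr \<alpha>))"
      unfolding step_def using integrable_affine_powr by (intro nn_integral_eq_integral) auto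
    moreover have "expectation (\<lambda>\<omega>. 1 + \<bar>A \<omega> * x + B \<omega>\<bar> powr \<alpha>)
        = 1 + expectation (\<lambda>\<omega>. \<bar>A \<omega> * x + B \<omega>\<bar> powr \<alpha>)"
      using integrable_affine_powr by (simp add: prob_space)
    ultimately show ?thesis by (simp only: ennreal_leI)
  qed
  have "(step ^^ n) ?g x \<le> ennreal (?D ^ n * (1 + \<bar>x\<bar> powr \<alpha>))" for x
  proof (induction n arbitrary: x)
    case (Suc n)
    have "(step ^^ Suc n) ?g x \<le> step (\<lambda>x. ennreal (?D ^ n) * ?g x) x"
      using Suc C1 by (auto simp: ennreal_mult' intro!: step_mono)
    also have "\<dots> = ennreal (?D ^ n) * step ?g x" by (rule step_cmult) measurable
    also have "\<dots> \<le> ennreal (?D ^ n) * ennreal (?D * (1 + \<bar>x\<bar> powr \<alpha>))"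
      by (intro mult_left_mono one) auto
    also have "\<dots> = ennreal (?D ^ Suc n * (1 + \<bar>x\<bar> powr \<alpha>))"
      using C1 by (simp add: ennreal_mult'[symmetric] mult_ac)
    finally show ?case .
  qed simp
  then show thesis using C1 by (intro that[of "?D ^ n"]) auto
qed

text \<open>
  The truncation \<open>g = (|x|^\<alpha> - K |x|^(\<alpha>-1) - v)^+\<close> has drift at least \<open>1\<close> where it is
  positive; elsewhere its drift becomes positive after \<open>N\<close> steps since the stationary law
  charges the region where \<open>g \<ge> 1\<close>. Summing the first \<open>N\<close> iterates gives a one-step drift.
\<close>

lemma step_lower_lyapunov:
  assumes st: "stationary_distribution M A B \<nu>" and unbd: "\<not> bounded (measure_support \<nu>)"
  obtains W :: "real \<Rightarrow> ennreal" and c C :: real where "W \<in> borel_measurable borel" "0 < c" "0 \<le> C"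
    "\<And>x. W x + ennreal c \<le> step W x" "\<And>x. W x \<le> ennreal (C * (1 + \<bar>x\<bar> powr \<alpha>))"
proof -
  obtain g r where [measurable]: "g \<in> borel_measurable borel" and r: "0 \<le> r"
    and g: "\<And>x. 0 \<le> g x" "\<And>x. g x \<le> \<bar>x\<bar> powr \<alpha>"
      "\<And>x. 0 < g x \<Longrightarrow> ennreal (g x + 1) \<le> step (\<lambda>x. ennreal (g x)) x"
      "\<And>x. r \<le> \<bar>x\<bar> \<Longrightarrow> 1 \<le> g x"
    using step_subharmonic by metis
  let ?g = "\<lambda>x. ennreal (g x)"
  obtain N c where N: "1 \<le> N" "0 < c"
    "\<And>x. \<bar>x\<bar> \<le> r \<Longrightarrow> ennreal c \<le> (step ^^ N) (\<lambda>x. ennreal (min 1 (max 0 (\<bar>x\<bar> - r)))) x"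
    using step_iterate_bounded_below[OF st unbd r] by metis
  have sub: "?g x \<le> step ?g x" for x
  proof (cases "0 < g x")
    case True
    have "?g x \<le> ennreal (g x + 1)" using g(1)[of x] by (intro ennreal_leI) auto
    with g(3)[OF True] show ?thesis by (rule order.trans[rotated])
  next
    case False
    then show ?thesis using g(1)[of x] by simp
  qed
  \<comment> \<open>Monotonicity of the operator applied to g \<le> \<open>step\<close> g makes the
    iterates increase, so a gain made in the first step is still present after N.\<close>
  have up: "step ?g x \<le> (step ^^ Suc n) ?g x" for n x
  proof (induction n)
    case (Suc n)
    have "(step ^^ Suc n) ?g x \<le> (step ^^ Suc n) (step ?g) x"
      by (rule step_iterate_mono) (rule sub)
    then have "(step ^^ Suc n) ?g x \<le> (step ^^ Suc (Suc n)) ?g x"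
      by (simp only: funpow_Suc_right comp_def)
    with Suc show ?case by (rule order.trans)
  qed simp
  \<comment> \<open>The gain over N steps is at least 1 where g > 0 and at least c where g = 0; the
    minimum serves both.\<close>
  define c' where "c' = min 1 c"
  have c': "0 < c'" "c' \<le> 1" "c' \<le> c" using N by (auto simp: c'_def)
  have drift: "?g x + ennreal c' \<le> (step ^^ N) ?g x" for x
  proof (cases "0 < g x")
    case True
    have "?g x + ennreal c' = ennreal (g x + c')" using g(1)[of x] c' by simp
    also have "\<dots> \<le> ennreal (g x + 1)" using c' by (intro ennreal_leI) auto
    also have "\<dots> \<le> step ?g x" by (rule g(3)[OF True])
    also have "\<dots> \<le> (step ^^ N) ?g x" using up[of x "N - 1"] N(1) by simp
    finally show ?thesis .
  next
    case False
    then have "g x = 0" using g(1)[of x] by simp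
    moreover have "\<bar>x\<bar> \<le> r" using g(4)[of x] False by force
    moreover have "ennreal (min 1 (max 0 (\<bar>y\<bar> - r))) \<le> ?g y" for y
      using g(1)[of y] g(4)[of y] by (intro ennreal_leI) (auto simp: min_def max_def)
    ultimately show ?thesis
      using N(3)[of x] c' step_iterate_mono[of "\<lambda>y. ennreal (min 1 (max 0 (\<bar>y\<bar> - r)))" ?g N x]
      by (auto intro: order.trans[OF ennreal_leI[OF c'(3)]])
  qed
  define W where "W x = (\<Sum>k<N. (step ^^ k) ?g x)" for x
  have "\<exists>C. 0 \<le> C \<and> (\<forall>x. (step ^^ k) (\<lambda>x. ennreal (1 + \<bar>x\<bar> powr \<alpha>)) x \<le> ennreal (C * (1 + \<bar>x\<bar> powr \<alpha>)))" for k
    by (rule step_iterate_powr_bound[of k]) blast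
  then obtain D where D: "\<And>k. 0 \<le> D k"
    "\<And>k x. (step ^^ k) (\<lambda>x. ennreal (1 + \<bar>x\<bar> powr \<alpha>)) x \<le> ennreal (D k * (1 + \<bar>x\<bar> powr \<alpha>))"
    by metis
  show thesis
  proof
    show "W \<in> borel_measurable borel" unfolding W_def[abs_def] by measurable
    show "0 < c'" by fact
    show "0 \<le> (\<Sum>k<N. D k)" by (intro sum_nonneg D)
    fix x :: real
    \<comment> \<open>Applying the operator to W shifts the index by one: the term g is exchanged
      for the N-th iterate, which exceeds it by at least c'.\<close>
    have "W x + ennreal c' \<le> (\<Sum>k<N. (step ^^ Suc k) ?g x)"
    proof -
      obtain m where m: "N = Suc m" using N by (cases N) auto
      have "W x + ennreal c' = (\<Sum>k<m. (step ^^ Suc k) ?g x) + (?g x + ennreal c')"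
        unfolding W_def m sum.lessThan_Suc_shift by (simp add: ac_simps)
      also have "\<dots> \<le> (\<Sum>k<m. (step ^^ Suc k) ?g x) + (step ^^ N) ?g x"
        by (intro add_left_mono drift)
      also have "\<dots> = (\<Sum>k<N. (step ^^ Suc k) ?g x)" by (simp add: m)
      finally show ?thesis .
    qed
    also have "\<dots> = step W x"
      unfolding W_def[abs_def] by (subst step_sum) auto
    finally show "W x + ennreal c' \<le> step W x" .
    have "W x \<le> (\<Sum>k<N. ennreal (D k * (1 + \<bar>x\<bar> powr \<alpha>)))"
      unfolding W_def
    proof (rule sum_mono)
      fix k
      have "(step ^^ k) ?g x \<le> (step ^^ k) (\<lambda>x. ennreal (1 + \<bar>x\<bar> powr \<alpha>)) x"
      proof (rule step_iterate_mono)
        show "?g y \<le> ennreal (1 + \<bar>y\<bar> powr \<alpha>)" for y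
          using g(2)[of y] by (intro ennreal_leI) simp
      qed
      with D(2)[of k x] show "(step ^^ k) ?g x \<le> ennreal (D k * (1 + \<bar>x\<bar> powr \<alpha>))"
        by (rule order.trans[rotated])
    qed
    also have "\<dots> = ennreal ((\<Sum>k<N. D k) * (1 + \<bar>x\<bar> powr \<alpha>))"
      using D by (subst sum_ennreal) (auto simp: sum_distrib_right)
    finally show "W x \<le> ennreal ((\<Sum>k<N. D k) * (1 + \<bar>x\<bar> powr \<alpha>))" .
  qed
qed

end

section \<open>Optional stopping and overshoot\<close>

text \<open>On the shells z0^k R < Y \<le> z0^(k+1) R the tail bound produces a geometric series of
  ratio z0^(p-p') < 1. The point is that the factor P(Y > R) is retained, so that a large value is
  charged to the event of exceeding R.\<close>

lemma (in prob_space) nn_integral_powr_tail: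
  fixes Y :: "'a \<Rightarrow> real"
  assumes [measurable]: "Y \<in> borel_measurable M"
    and R: "0 < R" and z0: "1 < z0" and C0: "0 \<le> C0" and p: "0 \<le> p" "p < p'"
    and tail: "\<And>z. z0 \<le> z \<Longrightarrow> prob {\<omega> \<in> space M. z * R < Y \<omega>}
      \<le> C0 / z powr p' * prob {\<omega> \<in> space M. R < Y \<omega>}"
  shows "(\<integral>\<^sup>+ \<omega>. ennreal (Y \<omega> powr p) * indicator {R<..} (Y \<omega>) \<partial>M)
    \<le> ennreal ((1 + C0) * z0 powr p / (1 - z0 powr (p - p')) * R powr p * prob {\<omega> \<in> space M. R < Y \<omega>})"
proof -
  let ?p = "prob {\<omega> \<in> space M. R < Y \<omega>}"
  define \<rho> where "\<rho> = z0 powr (p - p')"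
  have \<rho>: "0 \<le> \<rho>" "\<rho> < 1" using z0 p by (auto simp: \<rho>_def powr_less_one)
  define d where "d = (1 + C0) * z0 powr p * R powr p * ?p"
  have d: "0 \<le> d" using C0 by (simp add: d_def)
  have shell: "ennreal (y powr p) * indicator {R<..} y
      \<le> (\<Sum>k. ennreal ((z0 ^ Suc k * R) powr p) * indicator {z0 ^ k * R<..} y)" for y
  proof (cases "R < y")
    case True
    obtain n0 where "y / R < z0 ^ n0" using real_arch_pow[OF z0] by blast
    then have ex: "y \<le> z0 ^ n0 * R" using R by (simp add: field_simps)
    define n where "n = (LEAST n. y \<le> z0 ^ n * R)"
    have n: "y \<le> z0 ^ n * R" unfolding n_def by (rule LeastI) (rule ex)
    with True have "n \<noteq> 0" by (intro notI) simp
    then obtain k where k: "n = Suc k" by (cases n) auto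
    have "\<not> y \<le> z0 ^ k * R" by (rule not_less_Least) (simp add: n_def[symmetric] k)
    then have "ennreal (y powr p) * indicator {R<..} y
        \<le> ennreal ((z0 ^ Suc k * R) powr p) * indicator {z0 ^ k * R<..} y"
      using True R p n k by (auto intro!: ennreal_leI powr_mono2)
    also have "\<dots> \<le> (\<Sum>k. ennreal ((z0 ^ Suc k * R) powr p) * indicator {z0 ^ k * R<..} y)"
      using sum_le_suminf[of "\<lambda>k. ennreal ((z0 ^ Suc k * R) powr p) * indicator {z0 ^ k * R<..} y" "{k}"]
      by (simp only: sum.insert sum.empty finite.emptyI finite.insertI summableI empty_iff simp_thms
          zero_le add_0_right)
    finally show ?thesis .
  qed simp
  \<comment> \<open>The hypothesis starts only at z = z0; the summand 1 in 1 + C0 takes care of k =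
    0.\<close>
  have tail_k: "prob {\<omega> \<in> space M. z0 ^ k * R < Y \<omega>} \<le> (1 + C0) / (z0 ^ k) powr p' * ?p" for k
  proof (cases k)
    case 0
    then show ?thesis using C0 by (simp add: mult_le_cancel_right1)
  next
    case (Suc j)
    have "z0 * 1 \<le> z0 * z0 ^ j" using z0 by (intro mult_left_mono one_le_power) auto
    then have "prob {\<omega> \<in> space M. z0 ^ k * R < Y \<omega>} \<le> C0 / (z0 ^ k) powr p' * ?p"
      using Suc by (intro tail) simp
    also have "\<dots> \<le> (1 + C0) / (z0 ^ k) powr p' * ?p"
      by (intro mult_right_mono divide_right_mono) auto
    finally show ?thesis .
  qed
  have coeff: "(z0 ^ Suc k * R) powr p * ((1 + C0) / (z0 ^ k) powr p' * ?p) = d * \<rho> ^ k" for k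
  proof -
    have "(z0 ^ Suc k * R) powr p = z0 powr p * (z0 ^ k) powr p * R powr p"
      using z0 R by (simp add: powr_mult)
    moreover have "(z0 ^ k) powr p / (z0 ^ k) powr p' = \<rho> ^ k"
    proof -
      have "(z0 ^ k) powr p / (z0 ^ k) powr p' = (z0 ^ k) powr (p - p')" by (simp add: powr_diff)
      also have "\<dots> = \<rho> ^ k"
        using z0 by (simp add: \<rho>_def powr_realpow[symmetric] powr_powr mult.commute)
      finally show ?thesis .
    qed
    ultimately show ?thesis by (simp add: d_def divide_simps mult_ac) 
  qed
  have "(\<integral>\<^sup>+ \<omega>. ennreal (Y \<omega> powr p) * indicator {R<..} (Y \<omega>) \<partial>M)
      \<le> (\<integral>\<^sup>+ \<omega>. (\<Sum>k. ennreal ((z0 ^ Suc k * R) powr p) * indicator {z0 ^ k * R<..} (Y \<omega>)) \<partial>M)"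
    by (intro nn_integral_mono shell)
  also have "\<dots> = (\<Sum>k. \<integral>\<^sup>+ \<omega>. ennreal ((z0 ^ Suc k * R) powr p) * indicator {z0 ^ k * R<..} (Y \<omega>) \<partial>M)"
    by (rule nn_integral_suminf) measurable
  also have "\<dots> = (\<Sum>k. ennreal ((z0 ^ Suc k * R) powr p) * ennreal (prob {\<omega> \<in> space M. z0 ^ k * R < Y \<omega>}))"
  proof (rule suminf_cong)
    fix k
    have "(\<integral>\<^sup>+ \<omega>. ennreal ((z0 ^ Suc k * R) powr p) * indicator {z0 ^ k * R<..} (Y \<omega>) \<partial>M)
      = ennreal ((z0 ^ Suc k * R) powr p) * (\<integral>\<^sup>+ \<omega>. indicator {z0 ^ k * R<..} (Y \<omega>) \<partial>M)"
      by (rule nn_integral_cmult) measurable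
    also have "(\<integral>\<^sup>+ \<omega>. indicator {z0 ^ k * R<..} (Y \<omega>) \<partial>M)
        = (\<integral>\<^sup>+ \<omega>. indicator {\<omega> \<in> space M. z0 ^ k * R < Y \<omega>} \<omega> \<partial>M)"
      by (intro nn_integral_cong) (auto simp: indicator_def)
    also have "\<dots> = ennreal (prob {\<omega> \<in> space M. z0 ^ k * R < Y \<omega>})"
      by (simp add: emeasure_eq_measure)
    finally show "(\<integral>\<^sup>+ \<omega>. ennreal ((z0 ^ Suc k * R) powr p) * indicator {z0 ^ k * R<..} (Y \<omega>) \<partial>M)
      = ennreal ((z0 ^ Suc k * R) powr p) * ennreal (prob {\<omega> \<in> space M. z0 ^ k * R < Y \<omega>})" .
  qed
  also have "\<dots> \<le> (\<Sum>k. ennreal (d * \<rho> ^ k))"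
  proof (intro suminf_le)
    fix k
    have "(z0 ^ Suc k * R) powr p * prob {\<omega> \<in> space M. z0 ^ k * R < Y \<omega>} \<le> d * \<rho> ^ k"
      unfolding coeff[symmetric] by (intro mult_left_mono tail_k) auto
    then show "ennreal ((z0 ^ Suc k * R) powr p) * ennreal (prob {\<omega> \<in> space M. z0 ^ k * R < Y \<omega>})
        \<le> ennreal (d * \<rho> ^ k)"
      by (simp add: ennreal_mult'[symmetric] ennreal_leI)
  qed auto
  also have "\<dots> = ennreal (\<Sum>k. d * \<rho> ^ k)"
    using d \<rho> by (intro suminf_ennreal2) (auto intro!: summable_mult summable_geometric)
  also have "(\<Sum>k. d * \<rho> ^ k) = d / (1 - \<rho>)"
    using \<rho> by (simp add: suminf_mult suminf_geometric summable_geometric)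
  also have "d / (1 - \<rho>) = (1 + C0) * z0 powr p / (1 - z0 powr (p - p')) * R powr p * ?p"
    by (simp add: d_def \<rho>_def)
  finally show ?thesis .
qed

section \<open>Bookkeeping along paths that have not yet left [-R, R]\<close>

locale kesten_recursion = affine_recursion M A B As Bs + kesten_map M A B \<alpha>
  for M :: "'w measure" and A B As Bs \<alpha>
begin

definition survival :: "real \<Rightarrow> real \<Rightarrow> nat \<Rightarrow> ennreal" where
  "survival R x n = (\<integral>\<^sup>+ \<omega>. alive R x n \<omega> \<partial>M)"

text \<open>For |x| \<le> R this is P(\<tau> = n + 1): the index is the last time inside, not the
  exit time.\<close>

definition exit_prob :: "real \<Rightarrow> real \<Rightarrow> nat \<Rightarrow> ennreal" where
  "exit_prob R x n = (\<integral>\<^sup>+ \<omega>. alive R x n \<omega> * indicator {y. R < \<bar>y\<bar>} (affine_rec As Bs x (Suc n) \<omega>) \<partial>M)"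

text \<open>The usual E[f(X_n); \<tau> > n]. The weight vanishes unless |X_n| \<le> R, so integrands
  need comparing only there.\<close>

definition alive_integral :: "(real \<Rightarrow> ennreal) \<Rightarrow> real \<Rightarrow> real \<Rightarrow> nat \<Rightarrow> ennreal" where
  "alive_integral f R x n = (\<integral>\<^sup>+ \<omega>. alive R x n \<omega> * f (affine_rec As Bs x n \<omega>) \<partial>M)"

lemma alive_Suc:
  "alive R x n \<omega> * f (affine_rec As Bs x (Suc n) \<omega>)
    = alive R x (Suc n) \<omega> * f (affine_rec As Bs x (Suc n) \<omega>)
      + alive R x n \<omega> * (f (affine_rec As Bs x (Suc n) \<omega>) * indicator {y. R < \<bar>y\<bar>} (affine_rec As Bs x (Suc n) \<omega>))"
  by (auto simp: alive_def le_Suc_eq not_le split: split_indicator)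

text \<open>The next step either survives or exits. The exit part is pulled back to time n by the
  Markov property, so that it can be bounded pointwise in the last position inside [-R, R].\<close>

lemma alive_integral_step:
  assumes [measurable]: "f \<in> borel_measurable borel"
  shows "alive_integral (step f) R x n = alive_integral f R x (Suc n)
    + alive_integral (step (\<lambda>y. f y * indicator {y. R < \<bar>y\<bar>} y)) R x n"
proof -
  have "alive_integral (step f) R x n = (\<integral>\<^sup>+ \<omega>. alive R x n \<omega> * f (affine_rec As Bs x (Suc n) \<omega>) \<partial>M)"
    unfolding alive_integral_def by (rule nn_integral_alive_step[symmetric]) measurable
  also have "\<dots> = (\<integral>\<^sup>+ \<omega>. alive R x (Suc n) \<omega> * f (affine_rec As Bs x (Suc n) \<omega>) \<partial>M)
      + (\<integral>\<^sup>+ \<omega>. alive R x n \<omega> * (\<lambda>y. f y * indicator {y. R < \<bar>y\<bar>} y) (affine_rec As Bs x (Suc n) \<omega>) \<partial>M)"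
    unfolding alive_Suc[of _ _ _ _ f] by (rule nn_integral_add) measurable
  also have "\<dots> = alive_integral f R x (Suc n)
      + alive_integral (step (\<lambda>y. f y * indicator {y. R < \<bar>y\<bar>} y)) R x n"
    unfolding alive_integral_def by (subst nn_integral_alive_step) auto
  finally show ?thesis .
qed

lemma exit_prob_eq: "exit_prob R x n = alive_integral (step (indicator {y. R < \<bar>y\<bar>})) R x n"
  unfolding exit_prob_def alive_integral_def by (rule nn_integral_alive_step) measurable

lemma survival_Suc: "survival R x n = survival R x (Suc n) + exit_prob R x n"
proof -
  have "survival R x n = (\<integral>\<^sup>+ \<omega>. alive R x (Suc n) \<omega>
      + alive R x n \<omega> * indicator {y. R < \<bar>y\<bar>} (affine_rec As Bs x (Suc n) \<omega>) \<partial>M)"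
    unfolding survival_def using alive_Suc[of R x n _ "\<lambda>_. 1"] by simp
  also have "\<dots> = survival R x (Suc n) + exit_prob R x n"
    unfolding survival_def exit_prob_def by (rule nn_integral_add) measurable
  finally show ?thesis .
qed

lemma sum_exit_prob:
  assumes "\<bar>x\<bar> \<le> R"
  shows "(\<Sum>n<m. exit_prob R x n) + survival R x m = 1"
proof (induction m)
  case 0
  have "survival R x 0 = (\<integral>\<^sup>+ \<omega>. 1 \<partial>M)"
    unfolding survival_def alive_def using assms by simp
  then show ?case by (simp add: emeasure_space_1)
next
  case (Suc m)
  then show ?case by (simp add: survival_Suc[of R x m] ac_simps)
qed

lemma alive_integral_mono:
  "(\<And>y. \<bar>y\<bar> \<le> R \<Longrightarrow> f y \<le> g y) \<Longrightarrow> alive_integral f R x n \<le> alive_integral g R x n"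
  unfolding alive_integral_def by (intro nn_integral_mono) (auto simp: alive_def)

lemma alive_integral_add_const:
  assumes [measurable]: "f \<in> borel_measurable borel"
  shows "alive_integral (\<lambda>y. f y + c) R x n = alive_integral f R x n + c * survival R x n"
proof -
  have "alive_integral (\<lambda>y. f y + c) R x n
      = (\<integral>\<^sup>+ \<omega>. alive R x n \<omega> * f (affine_rec As Bs x n \<omega>) + c * alive R x n \<omega> \<partial>M)"
    unfolding alive_integral_def by (simp add: distrib_left mult.commute)
  also have "\<dots> = alive_integral f R x n + (\<integral>\<^sup>+ \<omega>. c * alive R x n \<omega> \<partial>M)"
    unfolding alive_integral_def by (rule nn_integral_add) measurable
  also have "(\<integral>\<^sup>+ \<omega>. c * alive R x n \<omega> \<partial>M) = c * survival R x n"
    unfolding survival_def by (rule nn_integral_cmult) measurable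
  finally show ?thesis .
qed

lemma alive_integral_cmult:
  assumes [measurable]: "f \<in> borel_measurable borel"
  shows "alive_integral (\<lambda>y. c * f y) R x n = c * alive_integral f R x n"
  unfolding alive_integral_def by (subst nn_integral_cmult[symmetric]) (auto simp: mult_ac)

lemma expected_exit_time_eq_survival: "expected_exit_time M As Bs R x = (\<Sum>n. survival R x n)"
  unfolding survival_def by (rule expected_exit_time_eq)

text \<open>Optional stopping at min(\<tau>, m): the partial sum of P(\<tau> > n) over n < m is E
  min(\<tau>, m), and c times it is at most the mean of W at the stopped time. Survivors contribute
  at most w and exits at most D, uniformly in m.\<close>

lemma expected_exit_time_le:
  assumes W [measurable]: "W \<in> borel_measurable borel" and c: "0 < c"
    and drift: "\<And>x. W x + ennreal c \<le> step W x"
    and bound: "\<And>y. \<bar>y\<bar> \<le> R \<Longrightarrow> W y \<le> ennreal w"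
    and overshoot: "\<And>y. \<bar>y\<bar> \<le> R \<Longrightarrow> step (\<lambda>y. W y * indicator {y. R < \<bar>y\<bar>} y) y
        \<le> ennreal D * step (indicator {y. R < \<bar>y\<bar>}) y"
    and x: "\<bar>x\<bar> \<le> R" and nonneg: "0 \<le> w" "0 \<le> D"
  shows "expected_exit_time M As Bs R x \<le> ennreal ((w + D) / c)"
proof -
  let ?I = "{y :: real. R < \<bar>y\<bar>}"
  have one: "alive_integral W R x n + ennreal c * survival R x n
      \<le> alive_integral W R x (Suc n) + ennreal D * exit_prob R x n" for n
  proof -
    have "alive_integral W R x n + ennreal c * survival R x n = alive_integral (\<lambda>y. W y + ennreal c) R x n"
      by (rule alive_integral_add_const[symmetric]) measurable
    also have "\<dots> \<le> alive_integral (step W) R x n"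
      by (intro alive_integral_mono drift)
    also have "\<dots> = alive_integral W R x (Suc n)
        + alive_integral (step (\<lambda>y. W y * indicator ?I y)) R x n"
      by (rule alive_integral_step) measurable
    also have "\<dots> \<le> alive_integral W R x (Suc n) + alive_integral (\<lambda>y. ennreal D * step (indicator ?I) y) R x n"
      by (intro add_left_mono alive_integral_mono overshoot)
    also have "alive_integral (\<lambda>y. ennreal D * step (indicator ?I) y) R x n = ennreal D * exit_prob R x n"
      unfolding exit_prob_eq by (rule alive_integral_cmult) measurable
    finally show ?thesis .
  qed
  \<comment> \<open>The base case discards the initial value of W, which is nonnegative.\<close>
  have sum: "ennreal c * (\<Sum>n<m. survival R x n) \<le> alive_integral W R x m + ennreal D * (\<Sum>n<m. exit_prob R x n)" for m
  proof (induction m)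
    case (Suc m)
    have "ennreal c * (\<Sum>n<Suc m. survival R x n)
        \<le> (alive_integral W R x m + ennreal D * (\<Sum>n<m. exit_prob R x n)) + ennreal c * survival R x m"
      using Suc by (simp add: distrib_left add_right_mono)
    also have "\<dots> = (alive_integral W R x m + ennreal c * survival R x m) + ennreal D * (\<Sum>n<m. exit_prob R x n)"
      by (simp add: ac_simps)
    also have "\<dots> \<le> (alive_integral W R x (Suc m) + ennreal D * exit_prob R x m) + ennreal D * (\<Sum>n<m. exit_prob R x n)"
      by (intro add_right_mono one)
    finally show ?case by (simp add: distrib_left ac_simps)
  qed simp
  have le: "ennreal c * (\<Sum>n<m. survival R x n) \<le> ennreal (w + D)" for m
  proof -
    have "alive_integral W R x m \<le> (\<integral>\<^sup>+ \<omega>. ennreal w \<partial>M)"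
      unfolding alive_integral_def using bound by (intro nn_integral_mono) (auto simp: alive_def)
    then have "alive_integral W R x m \<le> ennreal w" by (simp add: emeasure_space_1)
    moreover have "(\<Sum>n<m. exit_prob R x n) \<le> 1"
      unfolding sum_exit_prob[OF x, of m, symmetric] by simp
    then have "ennreal D * (\<Sum>n<m. exit_prob R x n) \<le> ennreal D * 1" by (rule mult_left_mono) simp
    ultimately show ?thesis
      using sum[of m] nonneg by (simp add: add_mono order.trans)
  qed
  have "(\<Sum>n<m. survival R x n) \<le> ennreal ((w + D) / c)" for m
  proof -
    have "(\<Sum>n<m. survival R x n) = ennreal (1 / c) * (ennreal c * (\<Sum>n<m. survival R x n))"
      using c by (simp add: mult.assoc[symmetric] ennreal_mult'[symmetric])
    also have "\<dots> \<le> ennreal (1 / c) * ennreal (w + D)" by (intro mult_left_mono le) simp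
    also have "\<dots> = ennreal ((w + D) / c)" using c by (simp add: ennreal_mult'[symmetric])
    finally show ?thesis .
  qed
  then show ?thesis
    unfolding expected_exit_time_eq_survival by (subst suminf_eq_SUP) (intro SUP_least)
qed

text \<open>At a time m by which exit has probability at least 1/2, the exited paths alone carry
  mean b/2, and this must have been built up from Z x by a drift of at most c per surviving step.
  Fixing such m explains the factor 1/2.\<close>

lemma expected_exit_time_ge:
  assumes Z [measurable]: "Z \<in> borel_measurable borel"
    and drift: "\<And>x. step Z x \<le> Z x + c"
    and large: "\<And>y. R < \<bar>y\<bar> \<Longrightarrow> b \<le> Z y"
    and x: "\<bar>x\<bar> \<le> R" and fin: "expected_exit_time M As Bs R x < \<infinity>"
  shows "b * ennreal (1 / 2) \<le> Z x + c * expected_exit_time M As Bs R x"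
proof -
  let ?I = "{y :: real. R < \<bar>y\<bar>}"
  have one: "alive_integral Z R x (Suc n) + b * exit_prob R x n
      \<le> alive_integral Z R x n + c * survival R x n" for n
  proof -
    have "b * exit_prob R x n = alive_integral (\<lambda>y. b * step (indicator ?I) y) R x n"
      unfolding exit_prob_eq by (rule alive_integral_cmult[symmetric]) measurable
    also have "(\<lambda>y. b * step (indicator ?I) y) = step (\<lambda>y. b * indicator ?I y)"
      by (intro ext step_cmult[symmetric]) measurable
    also have "alive_integral \<dots> R x n \<le> alive_integral (step (\<lambda>y. Z y * indicator ?I y)) R x n"
      using large by (intro alive_integral_mono step_mono) (auto split: split_indicator)
    finally have "alive_integral Z R x (Suc n) + b * exit_prob R x n \<le> alive_integral (step Z) R x n"
      by (subst alive_integral_step[OF Z]) (rule add_left_mono)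
    also have "\<dots> \<le> alive_integral (\<lambda>y. Z y + c) R x n"
      by (intro alive_integral_mono drift)
    also have "\<dots> = alive_integral Z R x n + c * survival R x n"
      by (rule alive_integral_add_const) measurable
    finally show ?thesis .
  qed
  have sum: "alive_integral Z R x m + b * (\<Sum>n<m. exit_prob R x n)
      \<le> Z x + c * (\<Sum>n<m. survival R x n)" for m
  proof (induction m)
    case 0
    have "alive_integral Z R x 0 \<le> (\<integral>\<^sup>+ \<omega>. Z x \<partial>M)"
      unfolding alive_integral_def by (intro nn_integral_mono) (auto simp: alive_def)
    then show ?case by (simp add: emeasure_space_1)
  next
    case (Suc m)
    have "alive_integral Z R x (Suc m) + b * (\<Sum>n<Suc m. exit_prob R x n)
        = (alive_integral Z R x (Suc m) + b * exit_prob R x m) + b * (\<Sum>n<m. exit_prob R x n)"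
      by (simp add: distrib_left ac_simps)
    also have "\<dots> \<le> (alive_integral Z R x m + c * survival R x m) + b * (\<Sum>n<m. exit_prob R x n)"
      by (intro add_right_mono one)
    also have "\<dots> = (alive_integral Z R x m + b * (\<Sum>n<m. exit_prob R x n)) + c * survival R x m"
      by (simp add: ac_simps)
    also have "\<dots> \<le> (Z x + c * (\<Sum>n<m. survival R x n)) + c * survival R x m"
      by (intro add_right_mono Suc)
    finally show ?case by (simp add: distrib_left ac_simps)
  qed
  \<comment> \<open>Otherwise every P(\<tau> > n) is at least 1/2 and their sum, the expected exit
    time, is infinite.\<close>
  obtain m where m: "survival R x m < ennreal (1 / 2)"
  proof (rule ccontr)
    assume "\<not> thesis"
    then have half: "ennreal (1 / 2) \<le> survival R x n" for n using that by (meson not_le)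
    have le: "ennreal (real m / 2) \<le> expected_exit_time M As Bs R x" for m :: nat
    proof -
      have "ennreal (real m / 2) = (\<Sum>n<m. ennreal (1 / 2))"
        by (subst sum_ennreal) auto
      also have "\<dots> \<le> (\<Sum>n<m. survival R x n)" by (intro sum_mono half)
      also have "\<dots> \<le> expected_exit_time M As Bs R x"
        unfolding expected_exit_time_eq_survival by (intro sum_le_suminf) auto
      finally show ?thesis .
    qed
    from fin obtain K where K: "0 \<le> K" "expected_exit_time M As Bs R x = ennreal K"
      by (cases "expected_exit_time M As Bs R x") auto
    obtain m :: nat where "2 * K < real m" using reals_Archimedean2 by blast
    with le[of m] K show False by simp
  qed
  have "ennreal (1 / 2) \<le> (\<Sum>n<m. exit_prob R x n)"
  proof (rule ccontr)
    assume "\<not> ?thesis"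
    then have "(\<Sum>n<m. exit_prob R x n) + survival R x m < ennreal (1 / 2) + ennreal (1 / 2)"
      using m by (intro add_strict_mono) auto
    also have "\<dots> = ennreal (1 / 2 + 1 / 2)" by (rule ennreal_plus[symmetric]) auto
    finally show False
      unfolding sum_exit_prob[OF x, of m] by simp
  qed
  then have "b * ennreal (1 / 2) \<le> b * (\<Sum>n<m. exit_prob R x n)" by (rule mult_left_mono) simp
  also have "\<dots> \<le> alive_integral Z R x m + b * (\<Sum>n<m. exit_prob R x n)" by simp
  also have "\<dots> \<le> Z x + c * (\<Sum>n<m. survival R x n)" by (rule sum)
  also have "\<dots> \<le> Z x + c * expected_exit_time M As Bs R x"
    unfolding expected_exit_time_eq_survival by (intro add_left_mono mult_left_mono sum_le_suminf) auto
  finally show ?thesis .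
qed

text \<open>Charging the overshoot to the probability of leaving in the same step makes the sum over
  time harmless, since exit probabilities add up to at most 1. For |y| > R \<ge> 1 the bound on W is
  at most 2 C |y|^\<alpha>, so the tail estimate applies to |Ax + B|.\<close>

lemma step_overshoot:
  assumes W: "\<And>x. W x \<le> ennreal (C * (1 + \<bar>x\<bar> powr \<alpha>))" "0 \<le> C"
    and z0: "1 < z0" and C0: "0 \<le> C0" and p: "\<alpha> < p" and R: "1 \<le> R"
    and tail: "\<And>z. z0 \<le> z \<Longrightarrow> prob {\<omega> \<in> space M. z * R < \<bar>A \<omega> * x + B \<omega>\<bar>}
      \<le> C0 / z powr p * prob {\<omega> \<in> space M. R < \<bar>A \<omega> * x + B \<omega>\<bar>}"
  shows "step (\<lambda>y. W y * indicator {y. R < \<bar>y\<bar>} y) x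
    \<le> ennreal (2 * C * ((1 + C0) * z0 powr \<alpha> / (1 - z0 powr (\<alpha> - p)) * R powr \<alpha>))
      * step (indicator {y. R < \<bar>y\<bar>}) x"
proof -
  let ?K = "(1 + C0) * z0 powr \<alpha> / (1 - z0 powr (\<alpha> - p)) * R powr \<alpha>"
  let ?Y = "\<lambda>\<omega>. \<bar>A \<omega> * x + B \<omega>\<bar>"
  have "z0 powr (\<alpha> - p) < 1" using z0 p by (simp add: powr_less_one)
  then have K: "0 \<le> ?K" using C0 by simp
  have "W y * indicator {y. R < \<bar>y\<bar>} y \<le> ennreal (2 * C) * (ennreal (\<bar>y\<bar> powr \<alpha>) * indicator {R<..} \<bar>y\<bar>)" for y
  proof (cases "R < \<bar>y\<bar>")
    case True
    have "1 \<le> \<bar>y\<bar> powr \<alpha>"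
      using True R two_le_alpha by (intro ge_one_powr_ge_zero) auto
    then have "C * (1 + \<bar>y\<bar> powr \<alpha>) \<le> C * (2 * \<bar>y\<bar> powr \<alpha>)"
      using W(2) by (intro mult_left_mono) auto
    then have "W y \<le> ennreal (2 * C * \<bar>y\<bar> powr \<alpha>)"
      by (intro order.trans[OF W(1)] ennreal_leI) (simp add: mult_ac)
    with True W(2) show ?thesis by (simp add: ennreal_mult')
  qed simp
  then have "step (\<lambda>y. W y * indicator {y. R < \<bar>y\<bar>} y) x
      \<le> step (\<lambda>y. ennreal (2 * C) * (ennreal (\<bar>y\<bar> powr \<alpha>) * indicator {R<..} \<bar>y\<bar>)) x"
    by (rule step_mono)
  also have "\<dots> = ennreal (2 * C) * step (\<lambda>y. ennreal (\<bar>y\<bar> powr \<alpha>) * indicator {R<..} \<bar>y\<bar>) x"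
    by (rule step_cmult) measurable
  also have "\<dots> \<le> ennreal (2 * C) * ennreal (?K * prob {\<omega> \<in> space M. R < ?Y \<omega>})"
    unfolding step_def
    by (intro mult_left_mono nn_integral_powr_tail[OF _ _ z0 C0 _ p tail]) (use R two_le_alpha in auto)
  finally have "step (\<lambda>y. W y * indicator {y. R < \<bar>y\<bar>} y) x
      \<le> ennreal (2 * C) * ennreal (?K * prob {\<omega> \<in> space M. R < ?Y \<omega>})"
    .
  also have "\<dots> = ennreal (2 * C * ?K) * ennreal (prob {\<omega> \<in> space M. R < ?Y \<omega>})"
    using K W(2) by (subst (1 2) ennreal_mult'[symmetric]) (simp_all only: mult.assoc mult_nonneg_nonneg zero_le_numeral)
  also have "ennreal (prob {\<omega> \<in> space M. R < ?Y \<omega>}) = step (indicator {y. R < \<bar>y\<bar>}) x"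
  proof -
    have "step (indicator {y. R < \<bar>y\<bar>}) x = (\<integral>\<^sup>+ \<omega>. indicator {\<omega> \<in> space M. R < ?Y \<omega>} \<omega> \<partial>M)"
      unfolding step_def by (intro nn_integral_cong) (auto simp: indicator_def)
    also have "\<dots> = ennreal (prob {\<omega> \<in> space M. R < ?Y \<omega>})" by (simp add: emeasure_eq_measure)
    finally show ?thesis ..
  qed
  finally show ?thesis .
qed

lemma expected_exit_time_upper:
  assumes st: "stationary_distribution M A B \<nu>" and unbd: "\<not> bounded (measure_support \<nu>)"
    and z0: "1 < z0" and C0: "0 \<le> C0" and p: "\<alpha> < p"
    and tail: "\<And>R z x. R0 \<le> R \<Longrightarrow> z0 \<le> z \<Longrightarrow> \<bar>x\<bar> \<le> R \<Longrightarrow>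
      prob {\<omega> \<in> space M. z * R < \<bar>A \<omega> * x + B \<omega>\<bar>} \<le> C0 / z powr p * prob {\<omega> \<in> space M. R < \<bar>A \<omega> * x + B \<omega>\<bar>}"
  shows "\<exists>Q. \<forall>\<^sub>F R in at_top. expected_exit_time M As Bs R x \<le> ennreal (Q * R powr \<alpha>)"
proof -
  obtain W and c C :: real where W [measurable]: "W \<in> borel_measurable borel" and c: "0 < c"
    and C: "0 \<le> C" and drift: "\<And>x. W x + ennreal c \<le> step W x"
    and WC: "\<And>x. W x \<le> ennreal (C * (1 + \<bar>x\<bar> powr \<alpha>))"
    using step_lower_lyapunov[OF st unbd] by metis
  let ?K = "(1 + C0) * z0 powr \<alpha> / (1 - z0 powr (\<alpha> - p))"
  have "z0 powr (\<alpha> - p) < 1" using z0 p by (simp add: powr_less_one)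
  then have K: "0 \<le> ?K" using C0 by simp
  \<comment> \<open>2 C R^\<alpha> bounds W inside [-R, R], the second summand bounds the overshoot,
    and c is the drift of W.\<close>
  have "expected_exit_time M As Bs R x \<le> ennreal ((2 * C + 2 * C * ?K) / c * R powr \<alpha>)"
    if R: "max 1 (max R0 \<bar>x\<bar>) \<le> R" for R
  proof -
    have R1: "1 \<le> R" and RR: "R0 \<le> R" and xR: "\<bar>x\<bar> \<le> R" using R by auto
    have "1 \<le> R powr \<alpha>" using R1 two_le_alpha by (intro ge_one_powr_ge_zero) auto
    then have "C * (1 + R powr \<alpha>) \<le> C * (2 * R powr \<alpha>)" using C by (intro mult_left_mono) auto
    moreover have "C * (1 + \<bar>y\<bar> powr \<alpha>) \<le> C * (1 + R powr \<alpha>)" if "\<bar>y\<bar> \<le> R" for y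
      using that C two_le_alpha by (intro mult_left_mono add_left_mono powr_mono2) auto
    ultimately have WR: "W y \<le> ennreal (2 * C * R powr \<alpha>)" if "\<bar>y\<bar> \<le> R" for y
      using that by (intro order.trans[OF WC] ennreal_leI) fastforce
    have "expected_exit_time M As Bs R x
        \<le> ennreal ((2 * C * R powr \<alpha> + 2 * C * (?K * R powr \<alpha>)) / c)"
    proof (rule expected_exit_time_le[OF W c drift WR _ xR])
      show "step (\<lambda>y. W y * indicator {y. R < \<bar>y\<bar>} y) y
          \<le> ennreal (2 * C * (?K * R powr \<alpha>)) * step (indicator {y. R < \<bar>y\<bar>}) y" if "\<bar>y\<bar> \<le> R" for y
        by (rule step_overshoot[OF WC C z0 C0 p R1 tail[OF RR _ that]])
      show "0 \<le> 2 * C * R powr \<alpha>" using C by simp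
      show "0 \<le> 2 * C * (?K * R powr \<alpha>)" using C K by (intro mult_nonneg_nonneg) auto
    qed
    also have "(2 * C * R powr \<alpha> + 2 * C * (?K * R powr \<alpha>)) / c = (2 * C + 2 * C * ?K) / c * R powr \<alpha>"
      by (simp only: distrib_right times_divide_eq_left mult.assoc)
    finally show ?thesis .
  qed
  then show ?thesis by (meson eventually_at_top_linorder)
qed

lemma expected_exit_time_lower:
  assumes fin: "\<forall>\<^sub>F R in at_top. expected_exit_time M As Bs R x < \<infinity>"
  shows "\<exists>q>0. \<forall>\<^sub>F R in at_top. ennreal (q * R powr \<alpha>) \<le> expected_exit_time M As Bs R x"
proof -
  obtain K C where K: "0 \<le> K" and C: "0 \<le> C"
    and drift: "\<And>x. step (\<lambda>x. ennreal (\<bar>x\<bar> powr \<alpha> + K * \<bar>x\<bar> powr (\<alpha> - 1))) x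
      \<le> ennreal (\<bar>x\<bar> powr \<alpha> + K * \<bar>x\<bar> powr (\<alpha> - 1) + C)"
    by (rule step_upper_lyapunov) blast
  let ?z = "\<lambda>x. \<bar>x\<bar> powr \<alpha> + K * \<bar>x\<bar> powr (\<alpha> - 1)"
  have z0: "0 \<le> ?z x" for x using K by simp
  have "\<forall>\<^sub>F R in at_top. max (max 1 \<bar>x\<bar>) (4 * ?z x) \<le> R" by (rule eventually_ge_at_top)
  with fin have "\<forall>\<^sub>F R in at_top. ennreal (1 / (4 * (C + 1)) * R powr \<alpha>) \<le> expected_exit_time M As Bs R x"
  proof eventually_elim
    case (elim R)
    then have R: "1 \<le> R" "\<bar>x\<bar> \<le> R" "4 * ?z x \<le> R" by auto
    from elim obtain t where t: "0 \<le> t" "expected_exit_time M As Bs R x = ennreal t"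
      by (cases "expected_exit_time M As Bs R x") auto
    have "ennreal (R powr \<alpha>) * ennreal (1 / 2) \<le> ennreal (?z x) + ennreal C * expected_exit_time M As Bs R x"
    proof (rule expected_exit_time_ge[where Z = "\<lambda>x. ennreal (?z x)"])
      show "step (\<lambda>x. ennreal (?z x)) y \<le> ennreal (?z y) + ennreal C" for y
        using drift[of y] z0[of y] C by (simp add: ennreal_plus[symmetric] del: ennreal_plus)
      show "ennreal (R powr \<alpha>) \<le> ennreal (?z y)" if "R < \<bar>y\<bar>" for y
      proof (rule ennreal_leI)
        have "R powr \<alpha> \<le> \<bar>y\<bar> powr \<alpha>" using that R two_le_alpha by (intro powr_mono2) auto
        with K show "R powr \<alpha> \<le> ?z y" by (simp add: add_increasing2)
      qed
    qed (use R elim in auto)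
    then have "ennreal (R powr \<alpha> * (1 / 2)) \<le> ennreal (?z x + C * t)"
      using t C z0[of x] by (simp only: ennreal_mult'[symmetric] ennreal_plus[symmetric]
          powr_ge_zero mult_nonneg_nonneg)
    then have "R powr \<alpha> * (1 / 2) \<le> ?z x + C * t"
      using z0[of x] C t by (subst (asm) ennreal_le_iff) (auto intro: add_nonneg_nonneg)
    moreover have "R powr 1 \<le> R powr \<alpha>" using R two_le_alpha by (intro powr_mono) auto
    then have "4 * ?z x \<le> R powr \<alpha>" using R by simp
    moreover have "C * t \<le> (C + 1) * t" using t by (simp add: distrib_right)
    \<comment> \<open>For large R the starting value uses at most R^\<alpha>/4 of the required
      R^\<alpha>/2, leaving R^\<alpha>/4 \<le> C t. Passing to C + 1 allows division even if C =
      0.\<close>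
    ultimately have "R powr \<alpha> \<le> 4 * ((C + 1) * t)" by argo
    then have "1 / (4 * (C + 1)) * R powr \<alpha> \<le> t" using C by (simp add: field_simps)
    then show ?case unfolding t(2) by (rule ennreal_leI)
  qed
  then show ?thesis using C by (intro exI[of _ "1 / (4 * (C + 1))"]) simp
qed

end

section \<open>From the hypotheses on (A, B) to the two-sided growth bound\<close>

theorem theorem3p5:
  fixes M :: "'w measure"
    and A B :: "'w \<Rightarrow> real"
    and As Bs :: "nat \<Rightarrow> 'w \<Rightarrow> real"
    and \<nu> :: "real measure"
    and \<alpha> :: real
  assumes prob: "prob_space M"
    and rv_A: "A \<in> borel_measurable M"
    and rv_B: "B \<in> borel_measurable M"
    and iid: "iid_copies M A B As Bs"
    and a: "lyapunov_exponent M As < 0"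
    and b: "\<exists>s>0. (\<integral>\<^sup>+ \<omega>. ennreal (\<bar>A \<omega>\<bar> powr s) \<partial>M) < \<infinity>"
    and c: "(\<integral>\<^sup>+ \<omega>. ennreal (ln (max \<bar>B \<omega>\<bar> 1)) \<partial>M) < \<infinity>"
    and d: "\<forall>x. measure M {\<omega> \<in> space M. A \<omega> * x + B \<omega> = x} < 1"
    and e1: "\<exists>s1>0. moment_growth M As s1 > 1"
    and e2: "0 < \<alpha>" "ereal \<alpha> < moment_abscissa M A" "moment_growth M As \<alpha> = 1"
    and stationary: "stationary_distribution M A B \<nu>"
    and f: "\<not> bounded (measure_support \<nu>)"
    and g: "\<exists>R0 z0 C0 \<alpha>p :: real. R0 > 1 \<and> z0 > 1 \<and> C0 > 0 \<and>
              \<alpha> < \<alpha>p \<and> ereal \<alpha>p \<le> moment_abscissa M A \<and>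
              (\<forall>R\<ge>R0. \<forall>z\<ge>z0. \<forall>x. \<bar>x\<bar> \<le> R \<longrightarrow>
                 measure M {\<omega> \<in> space M. \<bar>A \<omega> * x + B \<omega>\<bar> > z * R}
                   \<le> C0 / z powr \<alpha>p * measure M {\<omega> \<in> space M. \<bar>A \<omega> * x + B \<omega>\<bar> > R})"
    and h: "\<exists>n0\<ge>1. \<forall>x y. x \<noteq> 0 \<longrightarrow> y \<noteq> 0 \<longrightarrow>
              measure M {\<omega> \<in> space M. x * partial_prod As n0 \<omega> * y = 0} < 1"
    and alpha_ge_2: "\<alpha> \<ge> 2"
  shows "\<forall>x0.
     0 < Liminf at_top (\<lambda>R::real. expected_exit_time M As Bs R x0 / ennreal (R powr \<alpha>)) \<and>
     Liminf at_top (\<lambda>R::real. expected_exit_time M As Bs R x0 / ennreal (R powr \<alpha>))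
       \<le> Limsup at_top (\<lambda>R::real. expected_exit_time M As Bs R x0 / ennreal (R powr \<alpha>)) \<and>
     Limsup at_top (\<lambda>R::real. expected_exit_time M As Bs R x0 / ennreal (R powr \<alpha>)) < \<infinity>"
proof -
  interpret prob_space M by fact
  interpret affine_recursion M A B As Bs
    by unfold_locales fact+
  let ?I = "\<lambda>s. \<integral>\<^sup>+ \<omega>. ennreal (\<bar>A \<omega>\<bar> powr s) \<partial>M"
  from g obtain R0 z0 C0 p where R0: "1 < R0" and z0: "1 < z0" and C0: "0 < C0" and p: "\<alpha> < p"
    and "\<forall>R\<ge>R0. \<forall>z\<ge>z0. \<forall>x. \<bar>x\<bar> \<le> R \<longrightarrow> prob {\<omega> \<in> space M. \<bar>A \<omega> * x + B \<omega>\<bar> > z * R}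
      \<le> C0 / z powr p * prob {\<omega> \<in> space M. \<bar>A \<omega> * x + B \<omega>\<bar> > R}"
    by (elim exE conjE)
  then have tail: "\<And>R z x. R0 \<le> R \<Longrightarrow> z0 \<le> z \<Longrightarrow> \<bar>x\<bar> \<le> R \<Longrightarrow>
      prob {\<omega> \<in> space M. z * R < \<bar>A \<omega> * x + B \<omega>\<bar>} \<le> C0 / z powr p * prob {\<omega> \<in> space M. R < \<bar>A \<omega> * x + B \<omega>\<bar>}"
    by blast
  have "kesten_map M A B \<alpha>"
  proof
    show "2 \<le> \<alpha>" by fact
    show "?I \<alpha> = 1" using e2(3) by (simp add: moment_growth_eq)
    show "\<not> (AE \<omega> in M. \<bar>A \<omega>\<bar> = 1)"
    proof
      \<comment> \<open>If |A| = 1 almost surely, then h_A is identically 1, contrary to h_A(s1) >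
        1.\<close>
      assume AE: "AE \<omega> in M. \<bar>A \<omega>\<bar> = 1"
      have "?I s = 1" for s
      proof -
        have "?I s = (\<integral>\<^sup>+ \<omega>. 1 \<partial>M)" using AE by (intro nn_integral_cong_AE) auto
        then show ?thesis by (simp add: emeasure_space_1)
      qed
      with e1 show False by (auto simp: moment_growth_eq)
    qed
    have "(\<integral>\<^sup>+ \<omega>. ennreal (\<bar>B \<omega>\<bar> powr \<alpha>) \<partial>M)
        \<le> (\<integral>\<^sup>+ \<omega>. ennreal (R0 powr \<alpha>) + ennreal (\<bar>B \<omega>\<bar> powr \<alpha>) * indicator {R0<..} \<bar>B \<omega>\<bar> \<partial>M)"
      using e2(1) by (intro nn_integral_mono) (auto split: split_indicator intro!: ennreal_leI powr_mono2)
    also have "\<dots> = ennreal (R0 powr \<alpha>) + (\<integral>\<^sup>+ \<omega>. ennreal (\<bar>B \<omega>\<bar> powr \<alpha>) * indicator {R0<..} \<bar>B \<omega>\<bar> \<partial>M)"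
      by (subst nn_integral_add) (auto simp: emeasure_space_1)
    also have "\<dots> < \<infinity>"
    proof -
      \<comment> \<open>At x = 0 the affine image is B itself, so the tail hypothesis with R = R0
        controls the tail of |B| with exponent p > \<alpha>.\<close>
      have "prob {\<omega> \<in> space M. z * R0 < \<bar>B \<omega>\<bar>} \<le> C0 / z powr p * prob {\<omega> \<in> space M. R0 < \<bar>B \<omega>\<bar>}" if "z0 \<le> z" for z
        using tail[of R0 z 0] that R0 by simp
      then have "(\<integral>\<^sup>+ \<omega>. ennreal (\<bar>B \<omega>\<bar> powr \<alpha>) * indicator {R0<..} \<bar>B \<omega>\<bar> \<partial>M)
          \<le> ennreal ((1 + C0) * z0 powr \<alpha> / (1 - z0 powr (\<alpha> - p)) * R0 powr \<alpha> * prob {\<omega> \<in> space M. R0 < \<bar>B \<omega>\<bar>})"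
        using R0 z0 C0 p e2(1) by (intro nn_integral_powr_tail) auto
      also have "\<dots> < \<infinity>" by simp
      finally show ?thesis by simp
    qed
    finally show "(\<integral>\<^sup>+ \<omega>. ennreal (\<bar>B \<omega>\<bar> powr \<alpha>) \<partial>M) < \<infinity>" .
  qed
  then interpret kesten_recursion M A B As Bs \<alpha>
    by (intro kesten_recursion.intro affine_recursion_axioms)
  show ?thesis
  proof
    fix x0
    let ?E = "\<lambda>R. expected_exit_time M As Bs R x0"
    obtain Q where Q: "\<forall>\<^sub>F R in at_top. ?E R \<le> ennreal (Q * R powr \<alpha>)"
      using expected_exit_time_upper[OF stationary f z0 _ p tail] C0 by force
    then have "\<forall>\<^sub>F R in at_top. ?E R < \<infinity>"
      by eventually_elim (auto intro: le_less_trans)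
    from expected_exit_time_lower[OF this] obtain q where q: "0 < q"
      "\<forall>\<^sub>F R in at_top. ennreal (q * R powr \<alpha>) \<le> ?E R" by blast
    \<comment> \<open>Negative c is included because the sign of Q is not recorded;
      \<open>ennreal\<close> then sends both sides to 0.\<close>
    have quot: "ennreal (c * R powr \<alpha>) / ennreal (R powr \<alpha>) = ennreal c" if "0 < R" for c R
    proof (cases "0 \<le> c")
      case True
      with that show ?thesis by (simp add: divide_ennreal)
    next
      case False
      then show ?thesis by (simp add: ennreal_neg mult_nonpos_nonneg)
    qed
    have "\<forall>\<^sub>F R in at_top. ennreal q \<le> ?E R / ennreal (R powr \<alpha>)"
      using q(2) eventually_gt_at_top[of 0]
    proof eventually_elim
      case (elim R)
      then show ?case using quot[of R q] divide_right_mono_ennreal by metis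
    qed
    then have "ennreal q \<le> Liminf at_top (\<lambda>R. ?E R / ennreal (R powr \<alpha>))"
      by (rule Liminf_bounded)
    moreover have "0 < ennreal q" using q(1) by simp
    ultimately have "0 < Liminf at_top (\<lambda>R. ?E R / ennreal (R powr \<alpha>))" by (rule less_le_trans[rotated])
    moreover have "\<forall>\<^sub>F R in at_top. ?E R / ennreal (R powr \<alpha>) \<le> ennreal Q"
      using Q eventually_gt_at_top[of 0]
    proof eventually_elim
      case (elim R)
      then show ?case using quot[of R Q] divide_right_mono_ennreal by metis
    qed
    then have "Limsup at_top (\<lambda>R. ?E R / ennreal (R powr \<alpha>)) \<le> ennreal Q"
      by (rule Limsup_bounded)
    then have "Limsup at_top (\<lambda>R. ?E R / ennreal (R powr \<alpha>)) < \<infinity>"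
      by (rule le_less_trans) simp
    ultimately show "0 < Liminf at_top (\<lambda>R. ?E R / ennreal (R powr \<alpha>)) \<and>
        Liminf at_top (\<lambda>R. ?E R / ennreal (R powr \<alpha>)) \<le> Limsup at_top (\<lambda>R. ?E R / ennreal (R powr \<alpha>)) \<and>
        Limsup at_top (\<lambda>R. ?E R / ennreal (R powr \<alpha>)) < \<infinity>"
      by (simp add: Liminf_le_Limsup)
  qed
qed

end
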